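(* Let $K$ be an uncountable algebraically closed field of characteristic zero, let $m,n\ge1$, let $U\subset\mathbb B_{m,n}$ and let $X=\mathrm{Sol}(U)=\bigcap_{p\in U}\mathrm{Sol}(p)\subset\mathbb B[[t_1,\dots,t_m]]^n$. If $U=\mathrm{trop}([\Sigma])$, where $\Sigma\subset K_{m,n}$ is a system of homogeneous linear differential equations of differential type zero, then $\phi(X)\subset 2^{[n]\times\mathbb N^m}$ is the set of scrawls of $\phi(\mathcal C(\mathrm{Sol}(\Sigma)))$, i.e. the set of scrawls of the matroid on $[n]\times\mathbb N^m$ whose set of circuits is $\phi(\mathcal C(\mathrm{Sol}(\Sigma)))$.
   Context: Classical side. $K[[T]]=K[[t_1,\dots,t_m]]$; for $J\in\mathbb N^m$, $\Theta(J)=\partial^{|J|}/\partial t_1^{j_1}\cdots\partial t_m^{j_m}$. $K_{m,n}=K[[T]][x_{i,J}: 1\le i\le n, J\in\mathbb N^m]$ with $x_{i,J}=\Theta(J)x_i$. A homogeneous linear differential equation is $P=\sum_{i,J}\alpha_{i,J}x_{i,J}$ (finite sum, $\alpha_{i,J}\in K[[T]]$). $\varphi\in K[[T]]^n$ is a solution of $P\in K_{m,n}$ if $P$ vanishes after substituting $x_{i,J}\mapsto\Theta(J)\varphi_i$; $\mathrm{Sol}(\Sigma)\subset K[[T]]^n$ is the set of common solutions. $[\Sigma]\subset K_{m,n}$ is the differential ideal spanned by $\Sigma$: the smallest ideal containing $\Sigma$ and closed under the derivations. Differential type zero. Regard $\Sigma$ over $F=\mathrm{Frac}(K[[T]])$,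 fix a ranking on the $x_{i,J}$ (a well-ordering compatible with derivation), let $\Omega$ be an autoreduced (characteristic) set of the differential ideal generated by $\Sigma$, $L$ the set of leaders of $\Omega$, $\Theta L$ the set of all derivatives of elements of $L$, and $d=\#(\{x_{i,J}\}\setminus\Theta L)$, which is the transcendence degree of the general solution (for homogeneous linear $\Sigma$: the $F$-dimension of $\bigoplus_{i,J}Fx_{i,J}$ modulo the $F$-span of all $\Theta(J)P$, $P\in\Sigma$, $J\in\mathbb N^m$). $\Sigma$ is of differential type zero iff $d<\infty$. Supports. $\mathcal T(w)=\{J: a_J\neq0\}$ for $w=\sum a_Jt^J\in K[[T]]$, and $\mathcal T(Y)=\{(\mathcal T(w_1),\dots,\mathcal T(w_n)): w\in Y\}\subset(2^{\mathbb N^m})^n$ for $Y\subset K[[T]]^n$. $\mathcal C(\mathrm{Sol}(\Sigma))$ is the set of minimal elements of $\mathcal T(\mathrm{Sol}(\Sigma))\setminus\{(\emptyset,\dots,\emptyset)\}$ for componentwise inclusion. $\phi:(2^{\mathbb N^m})^n\to2^{[n]\times\mathbb N^m}$ is $\phi(S_1,\dots,S_n)=\{1\}\times S_1\cup\dots\cup\{n\}\times S_n$. Tropical side. $\mathbb B=\{0,1\}$ is the Boolean semifield ($1+1=1$); $\mathbb B[[T]]=\mathbb B[[t_1,\dots,t_m]]$ is identified with $2^{\mathbb N^m}$ via supports, with sum = union, product = Minkowski sum, and derivations $\partial_i(S)=\{(j_1,\dots,j_i-1,\dots,j_m): (j_1,\dots,j_m)\in S, j_i>0\}$; under this identification $\phi$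 is defined on $\mathbb B[[T]]^n$. $\mathbb B_{m,n}=\mathbb B[[T]][x_{i,J}]$. A monomial $E_M=\prod x_{i,J}^{m_{i,J}}$ is evaluated at $\varphi\in\mathbb B[[T]]^n$ as $E_M(\varphi)=\prod(\Theta(J)\varphi_i)^{m_{i,J}}$. $\mathrm{New}(A)$ is the convex hull of $\{I+J: I\in A,J\in\mathbb N^m\}$ for $A\subset\mathbb N^m$; $V:\mathbb B[[T]]\to V\mathbb B[T]$ is the quotient by the semiring congruence identifying series with equal Newton polyhedra, with addition $\oplus$. A sum $s=a_1\oplus\dots\oplus a_k$ tropically vanishes if for each $i$ it equals the sum obtained by omitting the $i$-th summand (the empty sum being $0$). $\varphi$ is a solution of $p=\sum_Ma_ME_M\in\mathbb B_{m,n}$ if $\bigoplus_MV(a_ME_M(\varphi))$ tropically vanishes; $\mathrm{Sol}(p)$ is the set of solutions. For $P=\sum_Ma_ME_M\in K_{m,n}$, $\mathrm{trop}(P)=\sum_M\mathcal T(a_M)E_M\in\mathbb B_{m,n}$, and $\mathrm{trop}([\Sigma])=\{\mathrm{trop}(P): P\in[\Sigma]\}$. Matroids (possibly infinite). $\mathcal C\subset 2^E$ is the set of circuits of a matroid on $E$ if: (i) $\emptyset\notin\mathcal C$; (ii) no element of $\mathcal C$ is a proper subset of another; (iii) whenever $X\subset C\in\mathcal C$ and $\{C_x: x\in X\}$ is a family in $\mathcal C$ with $x\in C_y\iff x=y$ for all $x,y\in X$, then for every $z\in C\setminus\bigcup_xC_x$ there is $C'\in\mathcal C$ with $z\in C'\subset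 (C\cup\bigcup_xC_x)\setminus X$; (iv) with $\mathcal I=\{I\subset E: C\not\subset I\ \forall C\in\mathcal C\}$, whenever $I\subset X\subset E$ and $I\in\mathcal I$, the set $\{I'\in\mathcal I: I\subset I'\subset X\}$ has a maximal element. The scrawls of a matroid are the unions of arbitrary families of its circuits (including $\emptyset$). *)

theory Defs
  imports
    "HOL-Analysis.Analysis"
    "HOL-Library.Poly_Mapping"
    "HOL-Library.Set_Algebras"
    "HOL-Computational_Algebra.Polynomial_Factorial"
begin

section \<open>Formal power series in finitely many variables\<close>

text \<open>
  The variables are indexed by a finite type \<open>'m\<close>, so that exponent vectors are elements
  of \<^typ>\<open>nat ^ 'm\<close>. The coefficients form an arbitrary commutative semiring, which covers both
  \<open>K[[T]]\<close> and \<open>\<bool>[[T]]\<close>.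
\<close>

typedef ('a, 'm::finite) mfps = "UNIV :: (nat ^ 'm \<Rightarrow> 'a) set"
  morphisms coeff Abs_mfps ..

setup_lifting type_definition_mfps

lemma mfps_eq_iff: "f = g \<longleftrightarrow> (\<forall>N. coeff f N = coeff g N)"
  by transfer auto

lemma mfps_eqI: "(\<And>N. coeff f N = coeff g N) \<Longrightarrow> f = g"
  by (simp add: mfps_eq_iff)

definition splits :: "nat ^ 'm \<Rightarrow> ((nat ^ 'm) \<times> (nat ^ 'm)) set" where
  "splits N = {(I, J). I + J = N}"

lemma in_splits: "(I, J) \<in> splits N \<longleftrightarrow> I + J = N"
  by (simp add: splits_def)

lemma finite_vec_le: "finite {I :: nat ^ 'm::finite. \<forall>i. I $ i \<le> N $ i}"
proof -
  have "{I :: nat ^ 'm. \<forall>i. I $ i \<le> N $ i} \<subseteq> vec_lambda ` (PiE UNIV (\<lambda>i. {..N $ i}))"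
  proof
    fix I :: "nat ^ 'm" assume "I \<in> {I. \<forall>i. I $ i \<le> N $ i}"
    then show "I \<in> vec_lambda ` (PiE UNIV (\<lambda>i. {..N $ i}))"
      by (intro image_eqI[of _ _ "vec_nth I"]) auto
  qed
  then show ?thesis
    by (rule finite_subset) (intro finite_imageI finite_PiE; simp)
qed

lemma finite_splits [simp]: "finite (splits (N :: nat ^ 'm::finite))"
proof -
  have "splits N \<subseteq> {I. \<forall>i. I $ i \<le> N $ i} \<times> {I. \<forall>i. I $ i \<le> N $ i}"
    by (auto simp: splits_def)
  then show ?thesis
    by (rule finite_subset) (intro finite_cartesian_product finite_vec_le)
qed

lemma vec_add_eq_0 [simp]: "(I :: nat ^ 'm::finite) + J = 0 \<longleftrightarrow> I = 0 \<and> J = 0"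
  by (auto simp: vec_eq_iff)

lemma sum_splits_assoc:
  fixes g :: "nat ^ 'm::finite \<Rightarrow> nat ^ 'm \<Rightarrow> nat ^ 'm \<Rightarrow> 'a::comm_monoid_add"
  shows "(\<Sum>(L, C)\<in>splits N. \<Sum>(A, B)\<in>splits L. g A B C)
       = (\<Sum>(A, M)\<in>splits N. \<Sum>(B, C)\<in>splits M. g A B C)"
proof -
  have "(\<Sum>(L, C)\<in>splits N. \<Sum>(A, B)\<in>splits L. g A B C)
      = (\<Sum>((L, C), (A, B))\<in>(SIGMA p:splits N. splits (fst p)). g A B C)"
    by (subst sum.Sigma[symmetric]) (auto simp: case_prod_unfold)
  also have "\<dots> = (\<Sum>((A, M), (B, C))\<in>(SIGMA p:splits N. splits (snd p)). g A B C)"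
    by (rule sum.reindex_bij_witness[where
          i = "\<lambda>((A, M), (B, C)). ((A + B, C), (A, B))" and
          j = "\<lambda>((L, C), (A, B)). ((A, B + C), (B, C))"])
       (auto simp: splits_def add.assoc)
  also have "\<dots> = (\<Sum>(A, M)\<in>splits N. \<Sum>(B, C)\<in>splits M. g A B C)"
    by (subst sum.Sigma[symmetric]) (auto simp: case_prod_unfold)
  finally show ?thesis .
qed

lemma sum_splits_swap: "(\<Sum>(I, J)\<in>splits N. g I J) = (\<Sum>(I, J)\<in>splits N. g J I)"
  by (rule sum.reindex_bij_witness[where i = prod.swap and j = prod.swap])
     (auto simp: splits_def add.commute)

instantiation mfps :: (comm_semiring_1, finite) comm_semiring_1
begin

lift_definition zero_mfps :: "('a, 'b) mfps" is "\<lambda>_. 0" .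
lift_definition one_mfps :: "('a, 'b) mfps" is "\<lambda>N. if N = 0 then 1 else 0" .
lift_definition plus_mfps :: "('a, 'b) mfps \<Rightarrow> ('a, 'b) mfps \<Rightarrow> ('a, 'b) mfps"
  is "\<lambda>f g N. f N + g N" .
lift_definition times_mfps :: "('a, 'b) mfps \<Rightarrow> ('a, 'b) mfps \<Rightarrow> ('a, 'b) mfps"
  is "\<lambda>f g N. \<Sum>(I, J)\<in>splits N. f I * g J" .

instance
proof
  fix a b c :: "('a, 'b) mfps"
  show "a + b + c = a + (b + c)" by transfer (auto simp: add.assoc)
  show "a + b = b + a" by transfer (auto simp: add.commute)
  show "0 + a = a" by transfer auto
  show "0 * a = 0" by transfer auto
  show "a * 0 = 0" by transfer auto
  show "(a + b) * c = a * c + b * c"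
    by transfer (auto simp: case_prod_unfold distrib_right sum.distrib)
  show "a * b = b * a"
  proof transfer
    fix a b :: "nat ^ 'b \<Rightarrow> 'a"
    show "(\<lambda>N. \<Sum>(I, J)\<in>splits N. a I * b J) = (\<lambda>N. \<Sum>(I, J)\<in>splits N. b I * a J)"
      by (subst sum_splits_swap) (simp add: mult.commute)
  qed
  show "a * b * c = a * (b * c)"
  proof transfer
    fix a b c :: "nat ^ 'b \<Rightarrow> 'a"
    have "(\<Sum>(I, J)\<in>splits N. (\<Sum>(I, J)\<in>splits I. a I * b J) * c J)
        = (\<Sum>(I, J)\<in>splits N. a I * (\<Sum>(I, J)\<in>splits J. b I * c J))" for N
      using sum_splits_assoc[of "\<lambda>I J L. a I * b J * c L" N]
      by (simp add: case_prod_unfold sum_distrib_left sum_distrib_right mult.assoc)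
    then show "(\<lambda>N. \<Sum>(I, J)\<in>splits N. (\<Sum>(I, J)\<in>splits I. a I * b J) * c J)
        = (\<lambda>N. \<Sum>(I, J)\<in>splits N. a I * (\<Sum>(I, J)\<in>splits J. b I * c J))"
      by auto
  qed
  show "1 * a = a"
  proof transfer
    fix a :: "nat ^ 'b \<Rightarrow> 'a"
    have "(\<Sum>(I, J)\<in>splits N. (if I = 0 then 1 else 0) * a J) = a N" for N
    proof -
      have "(\<Sum>(I, J)\<in>splits N. (if I = 0 then 1 else 0) * a J)
          = (\<Sum>(I, J)\<in>{(0 :: nat ^ 'b, N)}. (if I = 0 then 1 else 0) * a J)"
        by (rule sum.mono_neutral_right) (auto simp: in_splits split: if_splits)
      then show ?thesis by simp
    qed
    then show "(\<lambda>N. \<Sum>(I, J)\<in>splits N. (if I = 0 then 1 else 0) * a J) = a" by auto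
  qed
  show "(0 :: ('a, 'b) mfps) \<noteq> 1"
  proof transfer
    show "(\<lambda>_. 0 :: 'a) \<noteq> (\<lambda>N :: nat ^ 'b. if N = 0 then 1 else 0)"
      by (metis zero_neq_one)
  qed
qed

end

lemma coeff_0 [simp]: "coeff 0 N = 0"
  by transfer simp

lemma coeff_1: "coeff 1 N = (if N = 0 then 1 else 0)"
  by transfer simp

lemma coeff_add [simp]: "coeff (f + g) N = coeff f N + coeff g N"
  by transfer simp

lemma coeff_mult: "coeff (f * g) N = (\<Sum>(I, J)\<in>splits N. coeff f I * coeff g J)"
  by transfer simp

instantiation mfps :: (comm_ring_1, finite) comm_ring_1
begin

lift_definition uminus_mfps :: "('a, 'b) mfps \<Rightarrow> ('a, 'b) mfps" is "\<lambda>f N. - f N" .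
lift_definition minus_mfps :: "('a, 'b) mfps \<Rightarrow> ('a, 'b) mfps \<Rightarrow> ('a, 'b) mfps"
  is "\<lambda>f g N. f N - g N" .

instance
proof
  fix a b :: "('a, 'b) mfps"
  show "- a + a = 0" by transfer auto
  show "a - b = a + - b" by transfer auto
qed

end

definition supp :: "('a::zero, 'm::finite) mfps \<Rightarrow> (nat ^ 'm) set" where
  "supp f = {J. coeff f J \<noteq> 0}"

lemma supp_eq_empty_iff: "supp f = {} \<longleftrightarrow> f = 0"
  by (auto simp: supp_def mfps_eq_iff)

text \<open>
  The ring has no zero divisors: the lexicographically least exponents of two nonzero series
  cannot cancel. \<open>lexmin\<close> successively minimises along a list of coordinates.
\<close>

fun lexmin :: "'m list \<Rightarrow> (nat ^ 'm) set \<Rightarrow> (nat ^ 'm) set" where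
  "lexmin [] A = A"
| "lexmin (x # xs) A = lexmin xs {a \<in> A. \<forall>b\<in>A. a $ x \<le> b $ x}"

lemma lexmin_subset: "lexmin xs A \<subseteq> A"
  by (induction xs A rule: lexmin.induct) auto

lemma lexmin_nonempty: "A \<noteq> {} \<Longrightarrow> lexmin xs A \<noteq> {}"
proof (induction xs A rule: lexmin.induct)
  case (2 x xs A)
  from 2(2) obtain z where "z \<in> A" by auto
  then obtain a where "a \<in> A" "\<And>b. b \<in> A \<Longrightarrow> a $ x \<le> b $ x"
    using ex_has_least_nat[of "\<lambda>a. a \<in> A" z "\<lambda>a. a $ x"] by auto
  then have "{a \<in> A. \<forall>b\<in>A. a $ x \<le> b $ x} \<noteq> {}" by auto
  from 2(1)[OF this] show ?case by simp
qed auto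

lemma lexmin_eq_nth: "a \<in> lexmin xs A \<Longrightarrow> b \<in> lexmin xs A \<Longrightarrow> x \<in> set xs \<Longrightarrow> a $ x = b $ x"
proof (induction xs A rule: lexmin.induct)
  case (2 y xs A)
  have "a \<in> {a \<in> A. \<forall>b\<in>A. a $ y \<le> b $ y}" "b \<in> {a \<in> A. \<forall>b\<in>A. a $ y \<le> b $ y}"
    using 2(2,3) lexmin_subset[of xs "{a \<in> A. \<forall>b\<in>A. a $ y \<le> b $ y}"] by auto
  then have "a $ y = b $ y" by (auto intro: antisym)
  with 2 show ?case by auto
qed auto

lemma lexmin_add:
  assumes "a \<in> lexmin xs A" "b \<in> lexmin xs B" "a' \<in> A" "b' \<in> B" "a' + b' = a + b"
  shows "a' \<in> lexmin xs A \<and> b' \<in> lexmin xs B"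
  using assms
proof (induction xs arbitrary: A B)
  case (Cons x xs)
  let ?A = "{a \<in> A. \<forall>b\<in>A. a $ x \<le> b $ x}" and ?B = "{a \<in> B. \<forall>b\<in>B. a $ x \<le> b $ x}"
  have ab: "a \<in> ?A" "b \<in> ?B"
    using Cons.prems(1,2) lexmin_subset[of xs ?A] lexmin_subset[of xs ?B] by auto
  have sum: "a' $ x + b' $ x = a $ x + b $ x"
    using Cons.prems(5) by (metis vector_add_component)
  have "a $ x \<le> a' $ x" "b $ x \<le> b' $ x"
    using ab Cons.prems(3,4) by auto
  with sum have "a' $ x = a $ x" "b' $ x = b $ x" by linarith+
  with ab Cons.prems(3,4) have "a' \<in> ?A" "b' \<in> ?B" by auto
  with Cons.IH[of ?A ?B] Cons.prems show ?case by simp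
qed auto

instance mfps :: (idom, finite) idom
proof
  fix f g :: "('a, 'b) mfps"
  assume "f \<noteq> 0" "g \<noteq> 0"
  obtain xs :: "'b list" where xs: "set xs = UNIV"
    using finite_list[OF finite] by auto
  obtain a b where a: "a \<in> lexmin xs (supp f)" and b: "b \<in> lexmin xs (supp g)"
    using lexmin_nonempty[of "supp f" xs] lexmin_nonempty[of "supp g" xs]
      \<open>f \<noteq> 0\<close> \<open>g \<noteq> 0\<close> by (auto simp: supp_eq_empty_iff)
  have uniq: "a' = a \<and> b' = b"
    if "coeff f a' * coeff g b' \<noteq> 0" "a' + b' = a + b" for a' b'
  proof -
    from that have "a' \<in> supp f" "b' \<in> supp g" by (auto simp: supp_def)
    from lexmin_add[OF a b this that(2)]
    have "a' \<in> lexmin xs (supp f)" "b' \<in> lexmin xs (supp g)" by auto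
    then show ?thesis
      using lexmin_eq_nth a b xs by (metis UNIV_I vec_eq_iff)
  qed
  have "coeff (f * g) (a + b) = (\<Sum>(I, J)\<in>{(a, b)}. coeff f I * coeff g J)"
    unfolding coeff_mult
  proof (rule sum.mono_neutral_right)
    show "\<forall>p\<in>splits (a + b) - {(a, b)}. (case p of (I, J) \<Rightarrow> coeff f I * coeff g J) = 0"
    proof
      fix p assume p: "p \<in> splits (a + b) - {(a, b)}"
      obtain I J where [simp]: "p = (I, J)" by (cases p)
      from p have "I + J = a + b" "\<not> (I = a \<and> J = b)" by (auto simp: in_splits)
      with uniq[of I J] show "(case p of (I, J) \<Rightarrow> coeff f I * coeff g J) = 0" by auto
    qed
  qed (auto simp: in_splits)
  moreover have "a \<in> supp f" "b \<in> supp g"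
    using a b lexmin_subset by blast+
  ultimately have "coeff (f * g) (a + b) \<noteq> 0" by (simp add: supp_def)
  then show "f * g \<noteq> 0" by auto
qed

lift_definition mfps_deriv :: "'m::finite \<Rightarrow> ('a::comm_semiring_1, 'm) mfps \<Rightarrow> ('a, 'm) mfps"
  is "\<lambda>i f N. of_nat (N $ i + 1) * f (N + axis i 1)" .

lemma coeff_mfps_deriv: "coeff (mfps_deriv i f) N = of_nat (N $ i + 1) * coeff f (N + axis i 1)"
  by transfer simp

text \<open>
  \<open>iter_deriv d J\<close> is the operator \<open>\<Theta>(J)\<close>: every derivation \<open>d i\<close> is applied \<open>J $ i\<close> times. The
  derivations used below commute, so the order of the fold is irrelevant.
\<close>

definition iter_deriv :: "('m::finite \<Rightarrow> 'a \<Rightarrow> 'a) \<Rightarrow> nat ^ 'm \<Rightarrow> 'a \<Rightarrow> 'a" where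
  "iter_deriv d J f = Finite_Set.fold (\<lambda>i. (d i) ^^ (J $ i)) f UNIV"

lemma comp_fun_commute_funpow:
  assumes "\<And>i j. d i \<circ> d j = d j \<circ> d i"
  shows "comp_fun_commute (\<lambda>i. (d i) ^^ (J i))"
proof
  have 1: "(d j ^^ n) (d i x) = d i ((d j ^^ n) x)" for i j n x
    using assms by (induction n) (auto simp: fun_eq_iff)
  have "(d j ^^ n) ((d i ^^ k) x) = (d i ^^ k) ((d j ^^ n) x)" for i j n k x
    by (induction k) (auto simp: 1)
  then show "(d j ^^ J j) \<circ> (d i ^^ J i) = (d i ^^ J i) \<circ> (d j ^^ J j)" for i j
    by auto
qed

lemma iter_deriv_0 [simp]:
  assumes "\<And>i j. d i \<circ> d j = d j \<circ> d i"
  shows "iter_deriv d 0 f = f"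
proof -
  interpret comp_fun_commute "\<lambda>i. (d i) ^^ ((0 :: nat ^ 'a) $ i)"
    by (rule comp_fun_commute_funpow) (rule assms)
  have "Finite_Set.fold (\<lambda>i. (d i) ^^ ((0 :: nat ^ 'a) $ i)) f A = f" if "finite A" for A
    using that
  proof induction
    case (insert x F)
    then show ?case by (subst fold_insert) (auto simp: id_def)
  qed auto
  then show ?thesis by (simp add: iter_deriv_def)
qed

lemma iter_deriv_add_axis:
  fixes d :: "'m::finite \<Rightarrow> 'a \<Rightarrow> 'a"
  assumes "\<And>i j. d i \<circ> d j = d j \<circ> d i"
  shows "iter_deriv d (J + axis i 1) f = d i (iter_deriv d J f)"
proof -
  let ?J' = "J + axis i 1"
  interpret A: comp_fun_commute "\<lambda>i. (d i) ^^ (J $ i)"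
    by (rule comp_fun_commute_funpow) (rule assms)
  interpret B: comp_fun_commute "\<lambda>j. (d j) ^^ (?J' $ j)"
    by (rule comp_fun_commute_funpow) (rule assms)
  have eq: "Finite_Set.fold (\<lambda>j. (d j) ^^ (?J' $ j)) f A
      = Finite_Set.fold (\<lambda>j. (d j) ^^ (J $ j)) f A" if "finite A" "i \<notin> A" for A
    using that
  proof induction
    case (insert x F)
    then show ?case
      by (subst A.fold_insert, simp, simp, subst B.fold_insert) (auto simp: axis_def)
  qed auto
  have UNIV: "UNIV = insert i (UNIV - {i})" by auto
  show ?thesis
    unfolding iter_deriv_def
    by (subst (1 2) UNIV, subst A.fold_insert, simp, simp, subst B.fold_insert, simp, simp)
       (subst eq, simp, simp, simp add: axis_def)
qed

lemma mfps_deriv_commute: "mfps_deriv i \<circ> mfps_deriv j = mfps_deriv j \<circ> mfps_deriv i"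
proof (rule ext, rule mfps_eqI)
  fix f :: "('a, 'b) mfps" and N
  show "coeff ((mfps_deriv i \<circ> mfps_deriv j) f) N = coeff ((mfps_deriv j \<circ> mfps_deriv i) f) N"
    by (cases "i = j")
       (auto simp: coeff_mfps_deriv axis_def algebra_simps simp del: of_nat_add of_nat_Suc)
qed

lemma mfps_deriv_0 [simp]: "mfps_deriv i 0 = 0"
  by (rule mfps_eqI) (simp add: coeff_mfps_deriv)

lemma mfps_deriv_add: "mfps_deriv i (f + g) = mfps_deriv i f + mfps_deriv i g"
  by (rule mfps_eqI) (simp add: coeff_mfps_deriv distrib_left)

lemma mfps_deriv_1 [simp]: "mfps_deriv (i :: 'a::finite) 1 = 0"
proof (rule mfps_eqI)
  fix N :: "nat ^ 'a"
  have "(N + axis i 1) $ i \<noteq> 0" by (simp add: axis_def)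
  then have "N + axis i 1 \<noteq> 0" by (metis zero_index)
  then show "coeff (mfps_deriv i 1) N = coeff 0 N"
    by (simp add: coeff_mfps_deriv coeff_1)
qed

lemma sum_splits_axis:
  fixes h :: "nat ^ 'm::finite \<Rightarrow> nat ^ 'm \<Rightarrow> 'a::comm_semiring_1"
  shows "(\<Sum>(I, J)\<in>splits (N + axis i 1). of_nat (I $ i) * h I J)
       = (\<Sum>(I, J)\<in>splits N. of_nat (I $ i + 1) * h (I + axis i 1) J)"
proof -
  have "(\<Sum>(I, J)\<in>splits (N + axis i 1). of_nat (I $ i) * h I J)
      = (\<Sum>(I, J)\<in>{p \<in> splits (N + axis i 1). fst p $ i > 0}. of_nat (I $ i) * h I J)"
    by (rule sum.mono_neutral_right) (auto intro!: Nat.gr0I)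
  also have "\<dots> = (\<Sum>(I, J)\<in>splits N. of_nat (I $ i + 1) * h (I + axis i 1) J)"
  proof (rule sum.reindex_bij_witness[where
        i = "\<lambda>(I, J). (I + axis i 1, J)" and j = "\<lambda>(I, J). (I - axis i 1, J)"])
    have *: "I - axis i 1 + axis i 1 = I" if "I $ i > 0" for I :: "nat ^ 'm"
      using that by (auto simp: vec_eq_iff axis_def)
    fix p assume p: "p \<in> {p \<in> splits (N + axis i 1). fst p $ i > 0}"
    then obtain I J where [simp]: "p = (I, J)" and IJ: "I + J = N + axis i 1" "I $ i > 0"
      by (cases p) (auto simp: in_splits)
    show "(case case p of (I, J) \<Rightarrow> (I - axis i 1, J) of (I, J) \<Rightarrow> (I + axis i 1, J)) = p"
      using *[OF IJ(2)] by simp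
    have "(I - axis i 1 + J) + axis i 1 = N + axis i 1"
      using IJ(1) *[OF IJ(2)] by (metis add.assoc add.commute)
    then show "(case p of (I, J) \<Rightarrow> (I - axis i 1, J)) \<in> splits N"
      by (simp add: in_splits)
    show "(case case p of (I, J) \<Rightarrow> (I - axis i 1, J) of
        (I, J) \<Rightarrow> of_nat (I $ i + 1) * h (I + axis i 1) J) = (case p of (I, J) \<Rightarrow> of_nat (I $ i) * h I J)"
    proof -
      have "(I - axis i 1) $ i + 1 = I $ i"
        using IJ(2) by (simp add: axis_def)
      then show ?thesis
        using *[OF IJ(2)] by (simp del: of_nat_add of_nat_Suc vector_minus_component)
    qed
  qed (auto simp: in_splits ac_simps)
  finally show ?thesis .
qed

lemma mfps_deriv_mult: "mfps_deriv i (f * g) = mfps_deriv i f * g + f * mfps_deriv i g"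
proof (rule mfps_eqI)
  fix N
  let ?S = "splits (N + axis i 1)"
  have "coeff (mfps_deriv i (f * g)) N = (\<Sum>(I, J)\<in>?S. of_nat (N $ i + 1) * (coeff f I * coeff g J))"
    by (simp add: coeff_mfps_deriv coeff_mult sum_distrib_left case_prod_unfold)
  also have "\<dots> = (\<Sum>(I, J)\<in>?S. of_nat (I $ i) * (coeff f I * coeff g J) +
      of_nat (J $ i) * (coeff f I * coeff g J))"
  proof (rule sum.cong[OF refl])
    fix p assume "p \<in> ?S"
    then obtain I J where [simp]: "p = (I, J)" and IJ: "I + J = N + axis i 1"
      by (cases p) (auto simp: in_splits)
    have "I $ i + J $ i = N $ i + 1"
      using arg_cong[OF IJ, of "\<lambda>v. v $ i"] by simp
    then have "(of_nat (N $ i + 1) :: 'a) = of_nat (I $ i) + of_nat (J $ i)"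
      by (metis of_nat_add)
    then show "(case p of (I, J) \<Rightarrow> of_nat (N $ i + 1) * (coeff f I * coeff g J)) =
        (case p of (I, J) \<Rightarrow> of_nat (I $ i) * (coeff f I * coeff g J) +
          of_nat (J $ i) * (coeff f I * coeff g J))"
      by (simp add: distrib_right del: of_nat_Suc of_nat_add)
  qed
  also have "\<dots> = (\<Sum>(I, J)\<in>?S. of_nat (I $ i) * (coeff f I * coeff g J)) +
      (\<Sum>(I, J)\<in>?S. of_nat (J $ i) * (coeff f I * coeff g J))"
    by (simp add: case_prod_unfold sum.distrib)
  also have "(\<Sum>(I, J)\<in>?S. of_nat (I $ i) * (coeff f I * coeff g J)) = coeff (mfps_deriv i f * g) N"
    by (subst sum_splits_axis) (simp add: coeff_mult coeff_mfps_deriv case_prod_unfold mult.assoc)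
  also have "(\<Sum>(I, J)\<in>?S. of_nat (J $ i) * (coeff f I * coeff g J))
      = (\<Sum>(I, J)\<in>?S. of_nat (I $ i) * (coeff f J * coeff g I))"
    by (rule sum_splits_swap)
  also have "\<dots> = (\<Sum>(I, J)\<in>splits N. of_nat (I $ i + 1) * (coeff f J * coeff g (I + axis i 1)))"
    by (rule sum_splits_axis)
  also have "\<dots> = (\<Sum>(I, J)\<in>splits N. of_nat (J $ i + 1) * (coeff f I * coeff g (J + axis i 1)))"
    by (rule sum_splits_swap)
  also have "\<dots> = coeff (f * mfps_deriv i g) N"
    by (simp add: coeff_mult coeff_mfps_deriv case_prod_unfold mult.left_commute
          del: of_nat_Suc of_nat_add)
  finally show "coeff (mfps_deriv i (f * g)) N = coeff (mfps_deriv i f * g + f * mfps_deriv i g) N"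
    by simp
qed

abbreviation Theta :: "nat ^ 'm::finite \<Rightarrow> ('a::comm_semiring_1, 'm) mfps \<Rightarrow> ('a, 'm) mfps" where
  "Theta \<equiv> iter_deriv mfps_deriv"


section \<open>Differential polynomials\<close>

text \<open>
  The variable \<open>x\<^sub>i\<^sub>,\<^sub>J\<close> is the pair \<open>(i, J)\<close>, with \<open>i\<close> in a finite type \<open>'n\<close>. A monomial is a
  finitely supported function from variables to exponents.
\<close>

type_synonym ('m, 'n) dvar = "'n \<times> (nat ^ 'm)"
type_synonym ('m, 'n) dmono = "('m, 'n) dvar \<Rightarrow>\<^sub>0 nat"
type_synonym ('a, 'm, 'n) dpoly = "('m, 'n) dmono \<Rightarrow>\<^sub>0 ('a, 'm) mfps"

definition const_poly :: "'c \<Rightarrow> ('v \<Rightarrow>\<^sub>0 nat) \<Rightarrow>\<^sub>0 'c::zero" where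
  "const_poly c = Poly_Mapping.single 0 c"

definition var_poly :: "'v \<Rightarrow> ('v \<Rightarrow>\<^sub>0 nat) \<Rightarrow>\<^sub>0 'c::{zero,one}" where
  "var_poly v = Poly_Mapping.single (Poly_Mapping.single v 1) 1"

definition eval_mono ::
  "('m::finite, 'n) dmono \<Rightarrow> ('n \<Rightarrow> ('a::comm_semiring_1, 'm) mfps) \<Rightarrow> ('a, 'm) mfps" where
  "eval_mono M \<phi> =
     (\<Prod>(i, J)\<in>Poly_Mapping.keys M. Theta J (\<phi> i) ^ Poly_Mapping.lookup M (i, J))"

definition eval_poly ::
  "('a::comm_semiring_1, 'm::finite, 'n) dpoly \<Rightarrow> ('n \<Rightarrow> ('a, 'm) mfps) \<Rightarrow> ('a, 'm) mfps" where
  "eval_poly P \<phi> = (\<Sum>M\<in>Poly_Mapping.keys P. Poly_Mapping.lookup P M * eval_mono M \<phi>)"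

definition Sol :: "('a::comm_semiring_1, 'm::finite, 'n) dpoly set \<Rightarrow> ('n \<Rightarrow> ('a, 'm) mfps) set" where
  "Sol \<Sigma> = {\<phi>. \<forall>P\<in>\<Sigma>. eval_poly P \<phi> = 0}"

definition linear_homogeneous :: "('a::comm_semiring_1, 'm::finite, 'n) dpoly \<Rightarrow> bool" where
  "linear_homogeneous P \<longleftrightarrow> (\<forall>M\<in>Poly_Mapping.keys P. \<exists>v. M = Poly_Mapping.single v 1)"

text \<open>
  The derivation extending \<open>\<partial>\<^sub>i\<close> on the coefficients with \<open>\<partial>\<^sub>i x\<^sub>k\<^sub>,\<^sub>J = x\<^sub>k\<^sub>,\<^sub>J\<^sub>+\<^sub>e\<^sub>i\<close>, written out on the
  monomial \<open>a E\<^sub>M\<close> by the Leibniz rule: a factor \<open>x\<^sub>k\<^sub>,\<^sub>J\<close> is removed and \<open>x\<^sub>k\<^sub>,\<^sub>J\<^sub>+\<^sub>e\<^sub>i\<close> is inserted.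
\<close>

definition dterm_deriv ::
  "'m::finite \<Rightarrow> ('m, 'n) dmono \<Rightarrow> ('a::comm_semiring_1, 'm) mfps \<Rightarrow> ('a, 'm, 'n) dpoly" where
  "dterm_deriv i M a =
     Poly_Mapping.single M (mfps_deriv i a) +
     (\<Sum>(k, J)\<in>Poly_Mapping.keys M.
        Poly_Mapping.single
          (M - Poly_Mapping.single (k, J) 1 + Poly_Mapping.single (k, J + axis i 1) 1)
          (of_nat (Poly_Mapping.lookup M (k, J)) * a))"

definition dpoly_deriv ::
  "'m::finite \<Rightarrow> ('a::comm_semiring_1, 'm, 'n) dpoly \<Rightarrow> ('a, 'm, 'n) dpoly" where
  "dpoly_deriv i P = (\<Sum>M\<in>Poly_Mapping.keys P. dterm_deriv i M (Poly_Mapping.lookup P M))"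

text \<open>
  This is the unique derivation with the stated values on constants and variables
  (\<open>dpoly_deriv_const\<close>, \<open>dpoly_deriv_var\<close> below), and these derivations commute.
\<close>

lemma poly_mapping_additive_induct [case_names zero single add]:
  assumes "P 0" "\<And>k a. P (Poly_Mapping.single k a)" "\<And>f g. P f \<Longrightarrow> P g \<Longrightarrow> P (f + g)"
  shows "P (f :: 'a \<Rightarrow>\<^sub>0 'b::comm_monoid_add)"
proof (induction f rule: Poly_Mapping.update_induct)
  case (update f a b)
  have "Poly_Mapping.update a b f = Poly_Mapping.single a b + f"
    using update(1)
    by (intro poly_mapping_eqI)
       (auto simp: lookup_update lookup_add lookup_single when_def not_in_keys_iff_lookup_eq_zero)
  with update assms show ?case by metis
qed (fact assms(1))

lemma dterm_deriv_0 [simp]: "dterm_deriv i M 0 = 0"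
  by (auto simp: dterm_deriv_def case_prod_unfold)

lemma dterm_deriv_add: "dterm_deriv i M (a + b) = dterm_deriv i M a + dterm_deriv i M b"
  unfolding dterm_deriv_def mfps_deriv_add Poly_Mapping.single_add distrib_left
    case_prod_unfold sum.distrib by (simp only: ac_simps)

lemma dpoly_deriv_superset:
  assumes "finite A" "Poly_Mapping.keys P \<subseteq> A"
  shows "dpoly_deriv i P = (\<Sum>M\<in>A. dterm_deriv i M (Poly_Mapping.lookup P M))"
  unfolding dpoly_deriv_def
  by (rule sum.mono_neutral_left) (use assms in \<open>auto simp: not_in_keys_iff_lookup_eq_zero\<close>)

lemma dpoly_deriv_0 [simp]: "dpoly_deriv i 0 = 0"
  by (simp add: dpoly_deriv_def)

lemma dpoly_deriv_single: "dpoly_deriv i (Poly_Mapping.single M a) = dterm_deriv i M a"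
  by (subst dpoly_deriv_superset[of "{M}"]) auto

lemma dpoly_deriv_add: "dpoly_deriv i (P + Q) = dpoly_deriv i P + dpoly_deriv i Q"
proof -
  let ?A = "Poly_Mapping.keys P \<union> Poly_Mapping.keys Q"
  have "Poly_Mapping.keys (P + Q) \<subseteq> ?A" by (rule Poly_Mapping.keys_add)
  then show ?thesis
    by (simp add: dpoly_deriv_superset[of ?A] lookup_add dterm_deriv_add sum.distrib)
qed

lemma dterm_deriv_superset:
  assumes "finite A" "Poly_Mapping.keys M \<subseteq> A"
  shows "dterm_deriv i M a = Poly_Mapping.single M (mfps_deriv i a) +
     (\<Sum>v\<in>A. Poly_Mapping.single
          (M - Poly_Mapping.single v 1 + Poly_Mapping.single (fst v, snd v + axis i 1) 1)
          (of_nat (Poly_Mapping.lookup M v) * a))"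
proof -
  have "(\<Sum>(k, J)\<in>Poly_Mapping.keys M. Poly_Mapping.single
          (M - Poly_Mapping.single (k, J) 1 + Poly_Mapping.single (k, J + axis i 1) 1)
          (of_nat (Poly_Mapping.lookup M (k, J)) * a))
      = (\<Sum>v\<in>A. Poly_Mapping.single
          (M - Poly_Mapping.single v 1 + Poly_Mapping.single (fst v, snd v + axis i 1) 1)
          (of_nat (Poly_Mapping.lookup M v) * a))"
    unfolding case_prod_unfold prod.collapse
    by (rule sum.mono_neutral_left) (use assms in \<open>auto simp: not_in_keys_iff_lookup_eq_zero\<close>)
  then show ?thesis by (simp add: dterm_deriv_def)
qed

lemma dterm_deriv_mult:
  fixes a b :: "('a::comm_semiring_1, 'm::finite) mfps"
  shows "dterm_deriv i (M + N) (a * b) =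
    dterm_deriv i M a * Poly_Mapping.single N b + Poly_Mapping.single M a * dterm_deriv i N b"
proof -
  let ?A = "Poly_Mapping.keys M \<union> Poly_Mapping.keys N"
  let ?x = "\<lambda>v. Poly_Mapping.single v (1 :: nat)"
  let ?d = "\<lambda>v :: 'b \<times> (nat ^ 'm). ?x (fst v, snd v + axis i 1)"
  have shift: "(K + L) - ?x v + ?d v = (K - ?x v + ?d v) + L" if "Poly_Mapping.lookup K v \<noteq> 0" for K L v
    using that by (intro poly_mapping_eqI) (auto simp: lookup_add lookup_minus lookup_single when_def)
  have split: "Poly_Mapping.single ((M + N) - ?x v + ?d v) (of_nat (Poly_Mapping.lookup (M + N) v) * (a * b))
     = Poly_Mapping.single (M - ?x v + ?d v) (of_nat (Poly_Mapping.lookup M v) * a) * Poly_Mapping.single N b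
     + Poly_Mapping.single M a * Poly_Mapping.single (N - ?x v + ?d v) (of_nat (Poly_Mapping.lookup N v) * b)"
    for v
  proof -
    have 1: "Poly_Mapping.single ((M + N) - ?x v + ?d v) (of_nat (Poly_Mapping.lookup M v) * (a * b))
      = Poly_Mapping.single (M - ?x v + ?d v) (of_nat (Poly_Mapping.lookup M v) * a) * Poly_Mapping.single N b"
    proof (cases "Poly_Mapping.lookup M v = 0")
      case False
      then show ?thesis by (simp only: shift[OF False] mult_single mult.assoc)
    qed simp
    have 2: "Poly_Mapping.single ((M + N) - ?x v + ?d v) (of_nat (Poly_Mapping.lookup N v) * (a * b))
      = Poly_Mapping.single M a * Poly_Mapping.single (N - ?x v + ?d v) (of_nat (Poly_Mapping.lookup N v) * b)"
    proof (cases "Poly_Mapping.lookup N v = 0")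
      case False
      then show ?thesis
        by (simp only: add.commute[of M] shift[OF False] mult_single mult.left_commute)
    qed simp
    show ?thesis
      unfolding 1[symmetric] 2[symmetric]
      by (simp add: lookup_add distrib_right flip: Poly_Mapping.single_add)
  qed
  have "Poly_Mapping.keys (M + N) \<subseteq> ?A" by (rule Poly_Mapping.keys_add)
  then have "dterm_deriv i (M + N) (a * b) = Poly_Mapping.single (M + N) (mfps_deriv i (a * b)) +
     (\<Sum>v\<in>?A. Poly_Mapping.single ((M + N) - ?x v + ?d v) (of_nat (Poly_Mapping.lookup (M + N) v) * (a * b)))"
    by (intro dterm_deriv_superset) auto
  also have "\<dots> = dterm_deriv i M a * Poly_Mapping.single N b + Poly_Mapping.single M a * dterm_deriv i N b"
    unfolding split
    by (simp add: dterm_deriv_superset[of ?A M] dterm_deriv_superset[of ?A N] sum.distrib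
        sum_distrib_left sum_distrib_right distrib_left distrib_right mfps_deriv_mult
        Poly_Mapping.single_add mult_single ac_simps)
  finally show ?thesis .
qed

lemma dpoly_deriv_mult: "dpoly_deriv i (P * Q) = dpoly_deriv i P * Q + P * dpoly_deriv i Q"
proof (induction P rule: poly_mapping_additive_induct)
  case (single M a)
  show ?case
  proof (induction Q rule: poly_mapping_additive_induct)
    case (single N b)
    show ?case by (simp only: mult_single dpoly_deriv_single dterm_deriv_mult)
  next
    case (add f g)
    then show ?case by (simp add: dpoly_deriv_add distrib_left) (simp only: ac_simps)
  qed simp
next
  case (add f g)
  then show ?case by (simp add: dpoly_deriv_add distrib_right) (simp only: ac_simps)
qed simp

lemma dpoly_deriv_const: "dpoly_deriv i (const_poly a) = const_poly (mfps_deriv i a)"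
  by (simp add: const_poly_def dpoly_deriv_single dterm_deriv_def)

lemma dpoly_deriv_var: "dpoly_deriv i (var_poly (k, J)) = var_poly (k, J + axis i 1)"
  by (simp add: var_poly_def dpoly_deriv_single dterm_deriv_def)

lemma dpoly_deriv_commute:
  fixes i :: "'m::finite"
  shows "(dpoly_deriv i :: ('a::comm_semiring_1, 'm, 'n) dpoly \<Rightarrow> _) \<circ> dpoly_deriv j =
    dpoly_deriv j \<circ> dpoly_deriv i"
proof
  fix P :: "('a, 'm, 'n) dpoly"
  define C where "C P \<longleftrightarrow> dpoly_deriv i (dpoly_deriv j P) = dpoly_deriv j (dpoly_deriv i P)"
    for P :: "('a, 'm, 'n) dpoly"
  have C_mult: "C (P * Q)" if "C P" "C Q" for P Q
    using that by (simp add: C_def dpoly_deriv_mult dpoly_deriv_add ac_simps)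
  have C_var: "C (var_poly v)" for v
    by (cases v) (simp add: C_def dpoly_deriv_var add.assoc add.commute[of "axis i _"])
  have C_const: "C (const_poly a)" for a
    unfolding C_def dpoly_deriv_const by (metis comp_apply mfps_deriv_commute)
  have C_1: "C (Poly_Mapping.single 0 1)"
    using C_const[of 1] by (simp add: const_poly_def)
  have C_mono: "C (Poly_Mapping.single M 1)" for M
  proof (induction M rule: poly_mapping_additive_induct)
    case (single v n)
    show ?case
    proof (induction n)
      case (Suc n)
      have "Poly_Mapping.single (Poly_Mapping.single v (Suc n)) (1 :: ('a, 'm) mfps)
          = var_poly v * Poly_Mapping.single (Poly_Mapping.single v n) 1"
        by (simp add: var_poly_def mult_single flip: Poly_Mapping.single_add)
      with C_mult[OF C_var Suc] show ?case by metis
    qed (use C_1 in simp)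
  next
    case (add M N)
    from C_mult[OF this] show ?case by (simp add: mult_single)
  qed (use C_1 in simp)
  have "C P"
  proof (induction P rule: poly_mapping_additive_induct)
    case (single M a)
    from C_mult[OF C_const[of a] C_mono[of M]] show ?case
      by (simp add: const_poly_def mult_single)
  qed (simp_all add: C_def dpoly_deriv_add)
  then show "(dpoly_deriv i \<circ> dpoly_deriv j) P = (dpoly_deriv j \<circ> dpoly_deriv i) P"
    by (simp add: C_def)
qed

definition differential_ideal :: "('a::comm_ring_1, 'm::finite, 'n) dpoly set \<Rightarrow> bool" where
  "differential_ideal I \<longleftrightarrow>
     0 \<in> I \<and> (\<forall>P\<in>I. \<forall>Q\<in>I. P + Q \<in> I) \<and> (\<forall>R. \<forall>P\<in>I. R * P \<in> I) \<and>
     (\<forall>i. \<forall>P\<in>I. dpoly_deriv i P \<in> I)"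

definition diff_ideal_of ::
  "('a::comm_ring_1, 'm::finite, 'n) dpoly set \<Rightarrow> ('a, 'm, 'n) dpoly set" where
  "diff_ideal_of \<Sigma> = differential_ideal hull \<Sigma>"


section \<open>Differential type zero\<close>

text \<open>The ring of polynomials over a field \<open>F\<close>, as a vector space over \<open>F\<close>.\<close>

definition poly_scale :: "'f::field \<Rightarrow> (('v \<Rightarrow>\<^sub>0 nat) \<Rightarrow>\<^sub>0 'f) \<Rightarrow> (('v \<Rightarrow>\<^sub>0 nat) \<Rightarrow>\<^sub>0 'f)" where
  "poly_scale c p = const_poly c * p"

global_interpretation polyvs: vector_space poly_scale
  by standard
     (auto simp: poly_scale_def const_poly_def algebra_simps Poly_Mapping.single_add
        Poly_Mapping.mult_single simp flip: mult.assoc)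

definition over_Frac ::
  "(('v \<Rightarrow>\<^sub>0 nat) \<Rightarrow>\<^sub>0 ('k::field, 'm::finite) mfps) \<Rightarrow> ('v \<Rightarrow>\<^sub>0 nat) \<Rightarrow>\<^sub>0 ('k, 'm) mfps fract" where
  "over_Frac P = Poly_Mapping.map to_fract P"

text \<open>
  For a system of homogeneous linear equations, \<open>d\<close> is the dimension over \<open>F = Frac(K[[T]])\<close> of
  \<open>\<Oplus> F x\<^sub>i\<^sub>,\<^sub>J\<close> modulo the \<open>F\<close>-span of all derivatives of elements of the system. It is finite iff
  this quotient is spanned by (the classes of) finitely many linear forms.
\<close>

definition linear_forms :: "(('v \<Rightarrow>\<^sub>0 nat) \<Rightarrow>\<^sub>0 'f::field) set" where
  "linear_forms = polyvs.span (range var_poly)"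

definition derivative_span ::
  "('k::field, 'm::finite, 'n) dpoly set \<Rightarrow> (('m, 'n) dmono \<Rightarrow>\<^sub>0 ('k, 'm) mfps fract) set" where
  "derivative_span \<Sigma> = polyvs.span {over_Frac (iter_deriv dpoly_deriv J P) | P J. P \<in> \<Sigma>}"

definition differential_type_zero :: "('k::field, 'm::finite, 'n) dpoly set \<Rightarrow> bool" where
  "differential_type_zero \<Sigma> \<longleftrightarrow>
     (\<exists>B. finite B \<and> B \<subseteq> linear_forms \<and> linear_forms \<subseteq> polyvs.span (derivative_span \<Sigma> \<union> B))"


section \<open>The Boolean semifield and Boolean power series\<close>

datatype boolean = Zero | One

instantiation boolean :: comm_semiring_1
begin

definition "0 = Zero"
definition "1 = One"
definition "a + b = (if a = Zero then b else One)" for a b :: boolean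
definition "a * b = (if a = Zero then Zero else b)" for a b :: boolean

instance
proof
  fix a b c :: boolean
  show "a + b + c = a + (b + c)" "a + b = b + a" "0 + a = a" "0 * a = 0" "a * 0 = 0"
    "(a + b) * c = a * c + b * c" "a * b = b * a" "a * b * c = a * (b * c)" "1 * a = a"
    "(0::boolean) \<noteq> 1"
    by (cases a; cases b; cases c;
        simp add: zero_boolean_def one_boolean_def plus_boolean_def times_boolean_def)+
qed

end

lemma boolean_one_add_one: "(1 :: boolean) + 1 = 1"
  by (simp add: one_boolean_def plus_boolean_def)

lemma boolean_add_eq_0 [simp]: "(a :: boolean) + b = 0 \<longleftrightarrow> a = 0 \<and> b = 0"
  by (cases a; cases b; simp add: zero_boolean_def plus_boolean_def)

lemma boolean_mult_eq_0 [simp]: "(a :: boolean) * b = 0 \<longleftrightarrow> a = 0 \<or> b = 0"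
  by (cases a; cases b; simp add: zero_boolean_def times_boolean_def)

lemma boolean_sum_eq_0:
  fixes f :: "'b \<Rightarrow> boolean"
  shows "finite A \<Longrightarrow> sum f A = 0 \<longleftrightarrow> (\<forall>x\<in>A. f x = 0)"
  by (induction rule: finite_induct) auto

lemma boolean_of_nat_eq_0 [simp]: "(of_nat n :: boolean) = 0 \<longleftrightarrow> n = 0"
  by (induction n) auto

text \<open>
  Via \<^const>\<open>supp\<close>, \<open>\<bool>[[T]]\<close> is identified with the sets of exponent vectors; the operations become
  union, Minkowski sum and the shift that drops the exponents with \<open>j\<^sub>i = 0\<close>.
\<close>

lemma bij_supp_boolean: "bij (supp :: (boolean, 'm::finite) mfps \<Rightarrow> (nat ^ 'm) set)"
proof (rule bijI)
  show "inj (supp :: (boolean, 'm) mfps \<Rightarrow> _)"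
  proof (rule injI, rule mfps_eqI)
    fix f g :: "(boolean, 'm) mfps" and N
    assume "supp f = supp g"
    then have "coeff f N = 0 \<longleftrightarrow> coeff g N = 0" by (auto simp: supp_def)
    then show "coeff f N = coeff g N"
      by (cases "coeff f N"; cases "coeff g N") (auto simp: zero_boolean_def)
  qed
  show "surj (supp :: (boolean, 'm) mfps \<Rightarrow> _)"
  proof (rule surjI)
    show "supp (Abs_mfps (\<lambda>J. if J \<in> S then 1 else 0 :: boolean)) = S" for S
      by (auto simp: supp_def Abs_mfps_inverse)
  qed
qed

lemma supp_boolean_0: "supp (0 :: (boolean, 'm::finite) mfps) = {}"
  by (simp add: supp_eq_empty_iff)

lemma supp_boolean_1: "supp (1 :: (boolean, 'm::finite) mfps) = {0}"
  by (auto simp: supp_def coeff_1)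

lemma supp_boolean_add:
  "supp (f + g :: (boolean, 'm::finite) mfps) = supp f \<union> supp g"
  by (auto simp: supp_def)

lemma supp_boolean_mult:
  "supp (f * g :: (boolean, 'm::finite) mfps) = supp f + supp g"
  proof (rule set_eqI)
  fix N
  have "N \<in> supp (f * g) \<longleftrightarrow> (\<exists>p\<in>splits N. coeff f (fst p) * coeff g (snd p) \<noteq> 0)"
    by (simp add: supp_def coeff_mult boolean_sum_eq_0 case_prod_unfold)
  also have "\<dots> \<longleftrightarrow> N \<in> supp f + supp g"
    by (force simp: supp_def set_plus_def splits_def)
  finally show "N \<in> supp (f * g) \<longleftrightarrow> N \<in> supp f + supp g" .
qed

lemma supp_boolean_deriv:
  "supp (mfps_deriv i (f :: (boolean, 'm::finite) mfps)) = {J - axis i 1 | J. J \<in> supp f \<and> J $ i > 0}"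
proof (intro set_eqI iffI)
  fix N assume "N \<in> supp (mfps_deriv i f)"
  then have "N + axis i 1 \<in> supp f" by (auto simp: supp_def coeff_mfps_deriv)
  then show "N \<in> {J - axis i 1 | J. J \<in> supp f \<and> J $ i > 0}"
    by (intro CollectI exI[of _ "N + axis i 1"]) auto
next
  fix N assume "N \<in> {J - axis i 1 | J. J \<in> supp f \<and> J $ i > 0}"
  then obtain J where J: "N = J - axis i 1" "J \<in> supp f" "J $ i > 0" by auto
  then have "N + axis i 1 = J" by (auto simp: vec_eq_iff axis_def)
  with J show "N \<in> supp (mfps_deriv i f)"
    by (auto simp: supp_def coeff_mfps_deriv simp del: of_nat_add of_nat_Suc)
qed


section \<open>Newton polyhedra and tropical vanishing\<close>

definition real_vec :: "nat ^ 'm::finite \<Rightarrow> real ^ 'm" where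
  "real_vec I = (\<chi> i. real (I $ i))"

definition newton :: "(nat ^ 'm::finite) set \<Rightarrow> (real ^ 'm) set" where
  "newton A = convex hull {real_vec (I + J) | I J. I \<in> A}"

lemma newton_alt: "newton A = convex hull (real_vec ` (A + UNIV))"
  unfolding newton_def
  by (rule arg_cong[of _ _ "\<lambda>X. convex hull X"]) (force simp: set_plus_def)

lemma convex_hull_Un_hulls: "convex hull (S \<union> T) = convex hull (convex hull S \<union> convex hull T)"
proof
  show "convex hull (S \<union> T) \<subseteq> convex hull (convex hull S \<union> convex hull T)"
    by (intro hull_mono Un_mono hull_subset)
  show "convex hull (convex hull S \<union> convex hull T) \<subseteq> convex hull (S \<union> T)"
    by (intro hull_minimal convex_convex_hull Un_least hull_mono) auto
qed

lemma newton_Un: "newton (A \<union> B) = convex hull (newton A \<union> newton B)"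
proof -
  have "(A \<union> B) + UNIV = (A + UNIV) \<union> (B + UNIV)"
    by (auto simp: set_plus_def)
  then show ?thesis
    unfolding newton_alt by (simp only: image_Un) (rule convex_hull_Un_hulls)
qed

lemma newton_plus: "newton (A + B) = newton A + newton B"
proof -
  have "A + B + UNIV = (A + UNIV) + (B + (UNIV :: (nat ^ 'a) set))"
  proof -
    have "(UNIV :: (nat ^ 'a) set) + UNIV = UNIV"
      by (auto simp: set_plus_def intro: exI[of _ 0])
    then have "A + B + UNIV = A + B + (UNIV + (UNIV :: (nat ^ 'a) set))" by simp
    then show ?thesis by (simp only: add.assoc add.commute add.left_commute)
  qed
  moreover have "real_vec ` (X + Y) = real_vec ` X + real_vec ` Y" for X Y :: "(nat ^ 'a) set"
  proof -
    have *: "real_vec (x + y) = real_vec x + real_vec y" for x y :: "nat ^ 'a"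
      by (auto simp: real_vec_def vec_eq_iff)
    show ?thesis
    proof (intro equalityI subsetI)
      fix v assume "v \<in> real_vec ` (X + Y)"
      then obtain x y where "x \<in> X" "y \<in> Y" "v = real_vec (x + y)"
        by (elim imageE set_plus_elim) blast
      then show "v \<in> real_vec ` X + real_vec ` Y"
        unfolding * by (auto intro!: set_plus_intro)
    next
      fix v assume "v \<in> real_vec ` X + real_vec ` Y"
      then obtain x y where xy: "x \<in> X" "y \<in> Y" "v = real_vec x + real_vec y"
        by (elim imageE set_plus_elim) blast
      show "v \<in> real_vec ` (X + Y)"
        unfolding xy(3) *[symmetric] using xy(1,2) by (intro imageI set_plus_intro)
    qed
  qed
  ultimately show ?thesis
    unfolding newton_alt by (simp add: convex_hull_set_plus)
qed

text \<open>
  \<open>V\<bool>[T]\<close> is the quotient of \<open>\<bool>[[T]]\<close> by the semiring congruence given by equality of Newton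
  polyhedra. The quotient map \<open>V\<close> is \<open>abs_vseries\<close>, and \<open>\<oplus>\<close> is \<open>+\<close> on the type \<open>vseries\<close>.
\<close>

quotient_type 'm vseries = "(boolean, 'm::finite) mfps" / "\<lambda>f g. newton (supp f) = newton (supp g)"
  by (intro equivpI reflpI sympI transpI) auto

instantiation vseries :: (finite) comm_semiring_1
begin

lift_definition zero_vseries :: "'a vseries" is 0 .
lift_definition one_vseries :: "'a vseries" is 1 .
lift_definition plus_vseries :: "'a vseries \<Rightarrow> 'a vseries \<Rightarrow> 'a vseries" is "(+)"
  by (simp add: supp_boolean_add newton_Un)
lift_definition times_vseries :: "'a vseries \<Rightarrow> 'a vseries \<Rightarrow> 'a vseries" is "(*)"
  by (simp add: supp_boolean_mult newton_plus)

instance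
proof
  fix a b c :: "'a vseries"
  show "a + b + c = a + (b + c)" by transfer (simp add: add.assoc)
  show "a + b = b + a" by transfer (simp add: add.commute)
  show "0 + a = a" by transfer simp
  show "0 * a = 0" by transfer simp
  show "a * 0 = 0" by transfer simp
  show "(a + b) * c = a * c + b * c" by transfer (simp add: distrib_right)
  show "a * b = b * a" by transfer (simp add: mult.commute)
  show "a * b * c = a * (b * c)" by transfer (simp add: mult.assoc)
  show "1 * a = a" by transfer simp
  show "(0 :: 'a vseries) \<noteq> 1"
    proof transfer
    have "newton ({} :: (nat ^ 'a) set) = {}" by (simp add: newton_def)
    moreover have "real_vec 0 \<in> newton {0 :: nat ^ 'a}"
      unfolding newton_def by (rule hull_inc) (auto intro: exI[of _ 0])
    ultimately show "newton (supp (0 :: (boolean, 'a) mfps)) \<noteq> newton (supp (1 :: (boolean, 'a) mfps))"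
      unfolding supp_boolean_0 supp_boolean_1 by auto
  qed
qed

end

definition tropically_vanishes :: "'i set \<Rightarrow> ('i \<Rightarrow> 'm::finite vseries) \<Rightarrow> bool" where
  "tropically_vanishes A a \<longleftrightarrow> (\<forall>i\<in>A. sum a A = sum a (A - {i}))"

definition trop_Sol :: "(boolean, 'm::finite, 'n) dpoly set \<Rightarrow> ('n \<Rightarrow> (boolean, 'm) mfps) set" where
  "trop_Sol U = {\<phi>. \<forall>p\<in>U. tropically_vanishes (Poly_Mapping.keys p)
     (\<lambda>M. abs_vseries (Poly_Mapping.lookup p M * eval_mono M \<phi>))}"

lift_definition trop_series :: "('k::zero, 'm::finite) mfps \<Rightarrow> (boolean, 'm) mfps"
  is "\<lambda>f J. if f J = 0 then 0 else 1" .

lemma supp_trop_series: "supp (trop_series f) = supp f"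
  unfolding supp_def by transfer auto

definition trop :: "('k::comm_ring_1, 'm::finite, 'n) dpoly \<Rightarrow> (boolean, 'm, 'n) dpoly" where
  "trop P = Poly_Mapping.map trop_series P"


section \<open>Supports of solutions and matroids\<close>

definition supports :: "('n \<Rightarrow> ('a::zero, 'm::finite) mfps) set \<Rightarrow> ('n \<Rightarrow> (nat ^ 'm) set) set" where
  "supports Y = {\<lambda>i. supp (w i) | w. w \<in> Y}"

definition minimal_supports :: "('n \<Rightarrow> ('a::zero, 'm::finite) mfps) set \<Rightarrow> ('n \<Rightarrow> (nat ^ 'm) set) set" where
  "minimal_supports Y =
     {S \<in> supports Y - {\<lambda>_. {}}. \<forall>S'\<in>supports Y - {\<lambda>_. {}}. S' \<le> S \<longrightarrow> S' = S}"

definition flatten :: "('n \<Rightarrow> 'e set) \<Rightarrow> ('n \<times> 'e) set" where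
  "flatten S = (\<Union>i. {i} \<times> S i)"

definition circuit_independent :: "'e set set \<Rightarrow> 'e set \<Rightarrow> bool" where
  "circuit_independent \<C> I \<longleftrightarrow> (\<forall>C\<in>\<C>. \<not> C \<subseteq> I)"

definition matroid_circuits :: "'e set \<Rightarrow> 'e set set \<Rightarrow> bool" where
  "matroid_circuits E \<C> \<longleftrightarrow>
     \<C> \<subseteq> Pow E \<and>
     {} \<notin> \<C> \<and>
     (\<forall>C\<in>\<C>. \<forall>C'\<in>\<C>. \<not> C' \<subset> C) \<and>
     (\<forall>C\<in>\<C>. \<forall>X D. X \<subseteq> C \<and> (\<forall>x\<in>X. D x \<in> \<C>) \<and> (\<forall>x\<in>X. \<forall>y\<in>X. x \<in> D y \<longleftrightarrow> x = y) \<longrightarrow>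
        (\<forall>z \<in> C - (\<Union>x\<in>X. D x). \<exists>C'\<in>\<C>. z \<in> C' \<and> C' \<subseteq> (C \<union> (\<Union>x\<in>X. D x)) - X)) \<and>
     (\<forall>I X. I \<subseteq> X \<and> X \<subseteq> E \<and> circuit_independent \<C> I \<longrightarrow>
        (\<exists>M. circuit_independent \<C> M \<and> I \<subseteq> M \<and> M \<subseteq> X \<and>
           (\<forall>M'. circuit_independent \<C> M' \<and> M \<subseteq> M' \<and> M' \<subseteq> X \<longrightarrow> M' = M)))"

definition scrawls :: "'e set set \<Rightarrow> 'e set set" where
  "scrawls \<C> = {\<Union>\<A> | \<A>. \<A> \<subseteq> \<C>}"

end

theory Submission
  imports Defs
begin

text \<open>
  Write \<open>E\<close> for the set of pairs \<open>(i, J)\<close> and record a tuple of power series as the function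
  \<open>E \<Rightarrow> K\<close> of its coefficients. The proof rests on one observation: the solution space is the
  annihilator of a space \<open>V\<close> of finitely supported vectors. Take for \<open>V\<close> all functionals
  ``constant term of \<open>Q(\<phi>)\<close>'' with \<open>Q\<close> a linear form in the differential ideal; since the ideal is
  closed under derivation and the characteristic is zero, every coefficient of \<open>P(\<phi>)\<close>, for \<open>P\<close> in
  the system, is such a constant term up to a nonzero factor (\<open>Sol_iff_annihilator\<close>).

  Let \<open>W\<close> be the annihilator of any \<open>V\<close>. A point \<open>z\<close> can be separated from a set \<open>A\<close>, that is,
  some function in \<open>W\<close> vanishes on \<open>A\<close> but not at \<open>z\<close>, iff the unit vector at \<open>z\<close> is outside the
  span of \<open>V\<close> and the unit vectors of \<open>A\<close>. Hence the minimal supports are the circuits of the dual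
  of the linear matroid given by the unit vectors modulo \<open>V\<close>; the axioms hold on an infinite ground
  set because spans are finitary and bases exist (\<open>matroid_support_circuits\<close>). Each point of a
  support lies in a minimal support, so supports are scrawls. Conversely, every point of a scrawl
  \<open>S\<close> can be separated from the complement of \<open>S\<close>; as \<open>E\<close> is countable and \<open>K\<close> uncountable, a single
  function in \<open>W\<close> does this for all points at once (\<open>exists_support\<close>). So the scrawls are exactly
  the supports (\<open>scrawls_support_circuits\<close>).

  It remains to see that the tropical solutions are exactly the supports of solutions
  (\<open>flatten_supports_trop_Sol\<close>). The support of a solution is a tropical solution: if omitting one
  term of \<open>P(\<phi>)\<close> shrank the Newton polyhedron, then some monomial ordering would have its least
  exponent in that term alone; there the term cannot be cancelled, although \<open>P(\<phi>) = 0\<close>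
  (\<open>trop_vanishes_of_eval_poly_eq_0\<close>). Conversely, let \<open>S\<close> be the support of a tropical
  solution. If some \<open>z \<in> S\<close> could not be separated from the complement of \<open>S\<close>, the ideal would
  contain a linear form whose coefficient at \<open>z\<close> is a unit and whose coefficients at the other
  variables in \<open>S\<close> have constant term zero. Exactly one term of its tropicalization would then
  contain the exponent \<open>0\<close>, a vertex of every Newton polyhedron containing it, which contradicts
  tropical vanishing (\<open>trop_Sol_not_in_span\<close>).
\<close>


section \<open>Annihilators of finitely supported vectors\<close>

text \<open>
  Scalar multiplication on \<open>'e \<Rightarrow>\<^sub>0 'k\<close>, the vector space of finitely supported functions with the
  unit vectors as basis.
\<close>

definition pm_scale :: "'k::field \<Rightarrow> ('e \<Rightarrow>\<^sub>0 'k) \<Rightarrow> 'e \<Rightarrow>\<^sub>0 'k" where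
  "pm_scale c p = Poly_Mapping.map ((*) c) p"

abbreviation unit_vec :: "'e \<Rightarrow> 'e \<Rightarrow>\<^sub>0 'k::field" where
  "unit_vec x \<equiv> Poly_Mapping.single x 1"

text \<open>
  Through this pairing the space \<open>'e \<Rightarrow> 'k\<close> of all functions is the full algebraic dual of
  \<open>'e \<Rightarrow>\<^sub>0 'k\<close>, see \<open>linear_eq_pairing\<close> below.
\<close>

definition pairing :: "('e \<Rightarrow> 'k::field) \<Rightarrow> ('e \<Rightarrow>\<^sub>0 'k) \<Rightarrow> 'k" where
  "pairing w p = (\<Sum>x\<in>Poly_Mapping.keys p. Poly_Mapping.lookup p x * w x)"

text \<open>The functions orthogonal to \<open>V\<close>.\<close>

definition annihilator :: "('e \<Rightarrow>\<^sub>0 'k::field) set \<Rightarrow> ('e \<Rightarrow> 'k) set" where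
  "annihilator V = {w. \<forall>p\<in>V. pairing w p = 0}"

lemma lookup_pm_scale [simp]: "Poly_Mapping.lookup (pm_scale c p) x = c * Poly_Mapping.lookup p x"
  by (simp add: pm_scale_def Poly_Mapping.map.rep_eq when_def)

global_interpretation pmvs: vector_space pm_scale
  by standard (auto intro!: poly_mapping_eqI simp: lookup_add algebra_simps)

interpretation pmvs_pair: vector_space_pair pm_scale "(*) :: 'k::field \<Rightarrow> 'k \<Rightarrow> 'k"
  by (intro vector_space_pair.intro pmvs.vector_space_axioms
      vector_space_over_itself.vector_space_axioms)

lemma inj_unit_vec: "inj (unit_vec :: 'e \<Rightarrow> 'e \<Rightarrow>\<^sub>0 'k::field)"
  by (rule injI) (metis lookup_single_eq lookup_single_not_eq zero_neq_one)

lemma unit_vec_in_image_iff [simp]: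
  "(unit_vec x :: 'e \<Rightarrow>\<^sub>0 'k::field) \<in> unit_vec ` A \<longleftrightarrow> x \<in> A"
  by (rule inj_image_mem_iff[OF inj_unit_vec])

lemma unit_vec_eq_iff [simp]:
  "(unit_vec x :: 'e \<Rightarrow>\<^sub>0 'k::field) = unit_vec y \<longleftrightarrow> x = y"
  by (rule inj_eq[OF inj_unit_vec])

lemma sum_unit_vecs:
  "(\<Sum>x\<in>Poly_Mapping.keys p. pm_scale (Poly_Mapping.lookup p x) (unit_vec x)) = p"
  by (rule poly_mapping_eqI)
     (auto simp: lookup_sum lookup_single when_def not_in_keys_iff_lookup_eq_zero
        if_distrib[of "(*) _"] cong: if_cong)

lemma span_unit_vecs: "pmvs.span (range unit_vec) = UNIV"
proof -
  have "p \<in> pmvs.span (range unit_vec)" for p :: "'e \<Rightarrow>\<^sub>0 'k::field"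
    by (subst sum_unit_vecs[symmetric]) (intro pmvs.span_sum pmvs.span_scale pmvs.span_base; simp)
  then show ?thesis by auto
qed

lemma pairing_superset:
  assumes "finite A" "Poly_Mapping.keys p \<subseteq> A"
  shows "pairing w p = (\<Sum>x\<in>A. Poly_Mapping.lookup p x * w x)"
  unfolding pairing_def
  by (rule sum.mono_neutral_left) (use assms in \<open>auto simp: not_in_keys_iff_lookup_eq_zero\<close>)

lemma linear_pairing: "Vector_Spaces.linear pm_scale (*) (pairing w)"
  unfolding Vector_Spaces.linear_iff
proof (intro conjI allI)
  show "pairing w (p + q) = pairing w p + pairing w q" for p q
  proof -
    let ?A = "Poly_Mapping.keys p \<union> Poly_Mapping.keys q"
    have "pairing w (p + q) = (\<Sum>x\<in>?A. Poly_Mapping.lookup (p + q) x * w x)"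
      by (intro pairing_superset Poly_Mapping.keys_add) auto
    then show ?thesis
      by (simp add: pairing_superset[of ?A p] pairing_superset[of ?A q] lookup_add
          distrib_right sum.distrib)
  qed
  show "pairing w (pm_scale c p) = c * pairing w p" for c p
    by (subst pairing_superset[of "Poly_Mapping.keys p"])
       (auto simp: pairing_def sum_distrib_left mult.assoc in_keys_iff)
qed (auto intro: pmvs.vector_space_axioms vector_space_over_itself.vector_space_axioms)

lemma pairing_unit_vec [simp]: "pairing w (unit_vec x) = w x"
  by (simp add: pairing_def)

lemma linear_eq_pairing:
  assumes "Vector_Spaces.linear pm_scale (*) f"
  shows "f p = pairing (\<lambda>x. f (unit_vec x)) p"
  by (rule pmvs_pair.linear_eq_on[OF assms linear_pairing, of _ "range unit_vec"])
     (auto simp: span_unit_vecs)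

lemma annihilator_span:
  assumes w: "w \<in> annihilator V" and A: "\<And>a. a \<in> A \<Longrightarrow> w a = 0"
    and p: "p \<in> pmvs.span (V \<union> unit_vec ` A)"
  shows "pairing w p = 0"
proof -
  interpret f: Vector_Spaces.linear pm_scale "(*)" "pairing w" by (rule linear_pairing)
  show ?thesis
    by (rule f.eq_0_on_span[OF _ p]) (use w A in \<open>auto simp: annihilator_def\<close>)
qed

lemma annihilatorI_linear:
  assumes "Vector_Spaces.linear pm_scale (*) f" "\<And>v. v \<in> V \<Longrightarrow> f v = 0"
  shows "(\<lambda>x. f (unit_vec x)) \<in> annihilator V"
  unfolding annihilator_def
proof (intro CollectI ballI)
  fix p assume "p \<in> V"
  then show "pairing (\<lambda>x. f (unit_vec x)) p = 0"
    using assms(2) linear_eq_pairing[OF assms(1), of p] by metis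
qed

lemma annihilator_diff_sum:
  assumes "w \<in> annihilator V" "\<And>i. i \<in> I \<Longrightarrow> u i \<in> annihilator V"
  shows "(\<lambda>x. w x - (\<Sum>i\<in>I. c i * u i x)) \<in> annihilator V"
proof -
  have "pairing (\<lambda>x. w x - (\<Sum>i\<in>I. c i * u i x)) p = pairing w p - (\<Sum>i\<in>I. c i * pairing (u i) p)"
    for p
    unfolding pairing_def sum_distrib_left right_diff_distrib sum_subtractf
    by (subst (2) sum.swap) (simp add: mult.left_commute)
  with assms show ?thesis by (auto simp: annihilator_def)
qed


section \<open>The matroid of minimal supports\<close>

text \<open>The support of a function.\<close>

definition nonzeros :: "('e \<Rightarrow> 'k::zero) \<Rightarrow> 'e set" where
  "nonzeros w = {x. w x \<noteq> 0}"

text \<open>The inclusion-minimal nonempty supports of the functions in \<open>W\<close>.\<close>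

definition support_circuits :: "('e \<Rightarrow> 'k::zero) set \<Rightarrow> 'e set set" where
  "support_circuits W = {C \<in> nonzeros ` W - {{}}.
     \<forall>C'\<in>nonzeros ` W - {{}}. C' \<subseteq> C \<longrightarrow> C' = C}"

text \<open>
  Extend a basis of the span by \<open>unit_vec z\<close> and further unit vectors to a basis of the whole
  space. The coordinate functional at \<open>unit_vec z\<close> has minimal support, because a function of the
  annihilator with smaller support is determined by its value at \<open>z\<close>.
\<close>

lemma support_circuit_avoiding:
  fixes V :: "('e \<Rightarrow>\<^sub>0 'k::field) set"
  assumes z: "unit_vec z \<notin> pmvs.span (V \<union> unit_vec ` A)"
  obtains C where "C \<in> support_circuits (annihilator V)" "z \<in> C" "C \<inter> A = {}"
proof -
  obtain B0 where B0: "B0 \<subseteq> V" "pmvs.independent B0" "V \<subseteq> pmvs.span B0"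
    using pmvs.maximal_independent_subset[of V] by blast
  obtain B1 where B1: "B0 \<subseteq> B1" "B1 \<subseteq> V \<union> unit_vec ` A" "pmvs.independent B1"
    "V \<union> unit_vec ` A \<subseteq> pmvs.span B1"
    using pmvs.maximal_independent_subset_extend[of B0 "V \<union> unit_vec ` A"] B0 by blast
  have "unit_vec z \<notin> pmvs.span B1"
    using z pmvs.span_mono[OF B1(2)] by auto
  then have "pmvs.independent (insert (unit_vec z) B1)"
    by (intro pmvs.independent_insertI B1)
  then obtain B where B: "insert (unit_vec z) B1 \<subseteq> B"
    "B \<subseteq> insert (unit_vec z) B1 \<union> range unit_vec" "pmvs.independent B"
    "insert (unit_vec z) B1 \<union> range unit_vec \<subseteq> pmvs.span B"
    using pmvs.maximal_independent_subset_extend[of "insert (unit_vec z) B1"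
        "insert (unit_vec z) B1 \<union> range unit_vec"] by blast
  obtain f where f: "Vector_Spaces.linear pm_scale (*) f"
    and fB: "\<And>b. b \<in> B \<Longrightarrow> f b = (if b = unit_vec z then 1 else (0 :: 'k))"
    using pmvs_pair.linear_independent_extend[OF B(3), of "\<lambda>b. if b = unit_vec z then 1 else 0"]
    by blast
  interpret f: Vector_Spaces.linear pm_scale "(*)" f by (rule f)
  define w where "w x = f (unit_vec x)" for x
  have "unit_vec z \<notin> B1"
    using \<open>unit_vec z \<notin> pmvs.span B1\<close> pmvs.span_base by auto
  have f0: "f b = 0" if "b \<in> V \<union> unit_vec ` A" for b
  proof (rule f.eq_0_on_span)
    show "b \<in> pmvs.span B1" using B1(4) that by auto
    show "f x = 0" if "x \<in> B1" for x
      using fB[of x] that B(1) \<open>unit_vec z \<notin> B1\<close> by auto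
  qed
  have w: "w \<in> annihilator V"
    unfolding w_def by (rule annihilatorI_linear[OF f]) (use f0 in auto)
  have wz: "w z = 1" using fB[of "unit_vec z"] B(1) by (simp add: w_def)
  have "nonzeros w' = nonzeros w"
    if w': "w' \<in> annihilator V" "nonzeros w' \<noteq> {}" "nonzeros w' \<subseteq> nonzeros w" for w'
  proof -
    have eq: "w' x = w' z * w x" for x
    proof -
      have lin: "Vector_Spaces.linear pm_scale (*) (\<lambda>p. w' z * f p)"
        by (rule pmvs_pair.linear_compose_scale_right[OF f])
      have "pairing w' (unit_vec x) = w' z * f (unit_vec x)"
      proof (rule pmvs_pair.linear_eq_on[OF linear_pairing lin])
        show "unit_vec x \<in> pmvs.span B" using B(4) by auto
        fix b assume b: "b \<in> B"
        show "pairing w' b = w' z * f b"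
        proof (cases "b = unit_vec z")
          case False
          then have fb: "f b = 0" using fB[OF b] by simp
          have "pairing w' b = 0"
          proof (cases "b \<in> V")
            case True
            then show ?thesis using w'(1) by (auto simp: annihilator_def)
          next
            case bV: False
            then obtain y where y: "b = unit_vec y" using b B(2) B1(2) False by auto
            then have "w y = 0" using fb by (simp add: w_def)
            then have "w' y = 0" using w'(3) by (auto simp: nonzeros_def)
            then show ?thesis by (simp add: y)
          qed
          then show ?thesis by (simp add: fb)
        qed (use fB[OF b] in simp)
      qed
      then show ?thesis by (simp add: w_def)
    qed
    from w'(2) obtain y where "w' y \<noteq> 0" by (auto simp: nonzeros_def)
    then have "w' z \<noteq> 0" using eq[of y] by auto
    show ?thesis
    proof (intro set_eqI)
      show "x \<in> nonzeros w' \<longleftrightarrow> x \<in> nonzeros w" for x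
        using eq[of x] \<open>w' z \<noteq> 0\<close> unfolding nonzeros_def mem_Collect_eq by (metis mult_eq_0_iff)
    qed
  qed
  moreover have zw: "z \<in> nonzeros w" using wz by (simp add: nonzeros_def)
  ultimately have "nonzeros w \<in> support_circuits (annihilator V)"
    unfolding support_circuits_def using w by blast
  moreover have "nonzeros w \<inter> A = {}"
    using f0 by (auto simp: nonzeros_def w_def)
  ultimately show thesis
    using zw by (intro that[of "nonzeros w"])
qed

lemma support_circuit_memE:
  assumes "C \<in> support_circuits W"
  obtains w where "w \<in> W" "C = nonzeros w"
  using assms by (auto simp: support_circuits_def)

lemma not_in_span_if_separated:
  assumes "w \<in> annihilator V" "w z \<noteq> 0" "nonzeros w \<inter> A = {}"
  shows "unit_vec z \<notin> pmvs.span (V \<union> unit_vec ` A)"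
  using annihilator_span[OF assms(1), of A "unit_vec z"] assms(2,3)
  by (auto simp: nonzeros_def)

lemma circuit_independent_iff_spanning:
  fixes V :: "('e \<Rightarrow>\<^sub>0 'k::field) set"
  shows "circuit_independent (support_circuits (annihilator V)) I \<longleftrightarrow>
    range unit_vec \<subseteq> pmvs.span (V \<union> unit_vec ` (- I))" (is "?L \<longleftrightarrow> ?R")
proof
  assume L: ?L
  have "unit_vec z \<in> pmvs.span (V \<union> unit_vec ` (- I))" for z
  proof (rule ccontr)
    assume "\<not> ?thesis"
    then obtain C where "C \<in> support_circuits (annihilator V)" "C \<inter> (- I) = {}"
      using support_circuit_avoiding by metis
    with L show False by (auto simp: circuit_independent_def)
  qed
  then show ?R by auto
next
  assume R: ?R
  show ?L unfolding circuit_independent_def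
  proof (intro ballI notI)
    fix C assume C: "C \<in> support_circuits (annihilator V)" "C \<subseteq> I"
    then obtain w where w: "w \<in> annihilator V" "C = nonzeros w"
      using support_circuit_memE by metis
    from C obtain z where z: "z \<in> C" by (auto simp: support_circuits_def)
    then have "w z \<noteq> 0" using w by (auto simp: nonzeros_def)
    then have "unit_vec z \<notin> pmvs.span (V \<union> unit_vec ` (- I))"
      using C(2) w by (intro not_in_span_if_separated[OF w(1)]) auto
    with R show False by auto
  qed
qed

text \<open>
  Circuit elimination: membership in a span involves only finitely many vectors, so only finitely
  many of the functions belonging to the \<open>D x\<close> have to be subtracted, even if \<open>X\<close> is infinite.
\<close>

lemma support_circuit_elimination:
  fixes V :: "('e \<Rightarrow>\<^sub>0 'k::field) set"
  defines "\<C> \<equiv> support_circuits (annihilator V)"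
  assumes C: "C \<in> \<C>" and XC: "X \<subseteq> C" and D: "\<And>x. x \<in> X \<Longrightarrow> D x \<in> \<C>"
    and XD: "\<And>x y. x \<in> X \<Longrightarrow> y \<in> X \<Longrightarrow> x \<in> D y \<longleftrightarrow> x = y"
    and z: "z \<in> C - (\<Union>x\<in>X. D x)"
  obtains C' where "C' \<in> \<C>" "z \<in> C'" "C' \<subseteq> (C \<union> (\<Union>x\<in>X. D x)) - X"
proof -
  let ?Y = "- (C \<union> (\<Union>x\<in>X. D x))"
  obtain w where w: "w \<in> annihilator V" "C = nonzeros w"
    using C support_circuit_memE unfolding \<C>_def by metis
  have "\<forall>x\<in>X. \<exists>u. u \<in> annihilator V \<and> D x = nonzeros u"
    using D support_circuit_memE unfolding \<C>_def by metis
  then obtain u where u: "\<And>x. x \<in> X \<Longrightarrow> u x \<in> annihilator V" "\<And>x. x \<in> X \<Longrightarrow> D x = nonzeros (u x)"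
    by metis
  have "unit_vec z \<notin> pmvs.span (V \<union> unit_vec ` (X \<union> ?Y))"
  proof
    assume "unit_vec z \<in> pmvs.span (V \<union> unit_vec ` (X \<union> ?Y))"
    then obtain t r where t: "finite t" "t \<subseteq> V \<union> unit_vec ` (X \<union> ?Y)"
      "unit_vec z = (\<Sum>a\<in>t. pm_scale (r a) a)"
      unfolding pmvs.span_explicit by auto
    define X0 where "X0 = {x \<in> X. unit_vec x \<in> t}"
    have "finite X0"
      by (rule finite_subset[OF _ finite_vimageI[OF t(1) inj_unit_vec]]) (auto simp: X0_def)
    define w' where "w' x = w x - (\<Sum>i\<in>X0. (w i / u i i) * u i x)" for x
    have w': "w' \<in> annihilator V"
      unfolding w'_def by (rule annihilator_diff_sum) (use w u in \<open>auto simp: X0_def\<close>)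
    have "w' x = 0" if "x \<in> X0" for x
    proof -
      have "(\<Sum>i\<in>X0. (w i / u i i) * u i x) = (\<Sum>i\<in>{x}. (w i / u i i) * u i x)"
      proof (rule sum.mono_neutral_right)
        show "\<forall>i\<in>X0 - {x}. (w i / u i i) * u i x = 0"
        proof
          fix i assume i: "i \<in> X0 - {x}"
          with that have "x \<notin> D i" using XD[of x i] by (auto simp: X0_def)
          then show "(w i / u i i) * u i x = 0"
            using i u(2)[of i] by (auto simp: X0_def nonzeros_def)
        qed
      qed (use \<open>finite X0\<close> that in auto)
      moreover have "u x x \<noteq> 0"
        using that XD[of x x] u(2)[of x] by (auto simp: X0_def nonzeros_def)
      ultimately show ?thesis by (simp add: w'_def)
    qed
    moreover have "w' x = 0" if "x \<in> ?Y" for x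
    proof -
      have "w x = 0" using that w(2) by (auto simp: nonzeros_def)
      moreover have "u i x = 0" if "i \<in> X0" for i
        using that \<open>x \<in> ?Y\<close> u(2)[of i] by (auto simp: X0_def nonzeros_def)
      ultimately show ?thesis by (simp add: w'_def)
    qed
    moreover have "t \<subseteq> V \<union> unit_vec ` (X0 \<union> ?Y)"
      using t(2) by (auto simp: X0_def)
    then have "unit_vec z \<in> pmvs.span (V \<union> unit_vec ` (X0 \<union> ?Y))"
      unfolding t(3) by (intro pmvs.span_sum pmvs.span_scale pmvs.span_base) auto
    ultimately have "pairing w' (unit_vec z) = 0"
      by (intro annihilator_span[OF w', of "X0 \<union> ?Y"]) auto
    moreover have "u i z = 0" if "i \<in> X0" for i
      using that z u(2)[of i] by (auto simp: X0_def nonzeros_def)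
    then have "w' z = w z" by (simp add: w'_def)
    moreover have "w z \<noteq> 0" using z w(2) by (auto simp: nonzeros_def)
    ultimately show False by simp
  qed
  then obtain C' where "C' \<in> \<C>" "z \<in> C'" "C' \<inter> (X \<union> ?Y) = {}"
    using support_circuit_avoiding unfolding \<C>_def by metis
  then show thesis by (intro that[of C']) auto
qed

text \<open>
  A set is independent iff its complement spans. A maximal independent set between \<open>I\<close> and \<open>X\<close>
  is the complement of a minimal spanning set between \<open>- X\<close> and \<open>- I\<close>, which comes from a basis
  that first exhausts \<open>- X\<close>.
\<close>

lemma support_circuits_maximal_independent:
  fixes V :: "('e \<Rightarrow>\<^sub>0 'k::field) set"
  defines "\<C> \<equiv> support_circuits (annihilator V)"
  assumes IX: "I \<subseteq> X" and I: "circuit_independent \<C> I"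
  shows "\<exists>M. circuit_independent \<C> M \<and> I \<subseteq> M \<and> M \<subseteq> X \<and>
    (\<forall>M'. circuit_independent \<C> M' \<and> M \<subseteq> M' \<and> M' \<subseteq> X \<longrightarrow> M' = M)"
proof -
  obtain B0 where B0: "B0 \<subseteq> V" "pmvs.independent B0" "V \<subseteq> pmvs.span B0"
    using pmvs.maximal_independent_subset[of V] by blast
  obtain B1 where B1: "B0 \<subseteq> B1" "B1 \<subseteq> V \<union> unit_vec ` (- X)" "pmvs.independent B1"
    "V \<union> unit_vec ` (- X) \<subseteq> pmvs.span B1"
    using pmvs.maximal_independent_subset_extend[of B0 "V \<union> unit_vec ` (- X)"] B0 by blast
  have "B1 \<subseteq> V \<union> unit_vec ` (- I)" using B1(2) IX by auto
  then obtain B where B: "B1 \<subseteq> B" "B \<subseteq> V \<union> unit_vec ` (- I)" "pmvs.independent B"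
    "V \<union> unit_vec ` (- I) \<subseteq> pmvs.span B"
    using pmvs.maximal_independent_subset_extend[of B1 "V \<union> unit_vec ` (- I)"] B1(3) by blast
  define M where "M = {x \<in> X. unit_vec x \<notin> B - B1}"
  have spanB: "range unit_vec \<subseteq> pmvs.span B"
    using I pmvs.span_minimal[OF B(4)]
    unfolding \<C>_def circuit_independent_iff_spanning by auto
  have IM: "I \<subseteq> M"
  proof
    fix x assume x: "x \<in> I"
    have False if "unit_vec x \<in> B - B1"
    proof -
      have "unit_vec x \<notin> V"
      proof
        assume "unit_vec x \<in> V"
        then have "unit_vec x \<in> pmvs.span B1" using B1(4) by auto
        also have "\<dots> \<subseteq> pmvs.span (B - {unit_vec x})"
          using that B(1) by (intro pmvs.span_mono) auto
        finally show False using B(3) that unfolding pmvs.dependent_def by blast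
      qed
      then have "unit_vec x \<in> (unit_vec ` (- I) :: ('e \<Rightarrow>\<^sub>0 'k) set)" using that B(2) by auto
      then show False using x inj_unit_vec by (auto dest: injD)
    qed
    then show "x \<in> M" using x IX by (auto simp: M_def)
  qed
  have M: "circuit_independent \<C> M"
    unfolding \<C>_def circuit_independent_iff_spanning
  proof -
    have "B \<subseteq> V \<union> unit_vec ` (- M)"
    proof
      fix b assume b: "b \<in> B"
      show "b \<in> V \<union> unit_vec ` (- M)"
      proof (cases "b \<in> B1")
        case True
        then show ?thesis using B1(2) by (auto simp: M_def)
      next
        case False
        with b B(2) show ?thesis by (auto simp: M_def)
      qed
    qed
    then show "range unit_vec \<subseteq> pmvs.span (V \<union> unit_vec ` (- M))"
      using spanB pmvs.span_mono by blast
  qed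
  have "M' = M" if M': "circuit_independent \<C> M'" "M \<subseteq> M'" "M' \<subseteq> X" for M'
  proof (rule ccontr)
    assume "M' \<noteq> M"
    then obtain x where x: "x \<in> M'" "x \<notin> M" using M'(2) by auto
    then have xB: "unit_vec x \<in> B - B1" using M'(3) by (auto simp: M_def)
    let ?S = "pmvs.span (B - {unit_vec x})"
    have "B1 \<subseteq> B - {unit_vec x}" using B(1) xB by auto
    then have "V \<union> unit_vec ` (- X) \<subseteq> ?S"
      using B1(4) pmvs.span_mono by blast
    moreover have "unit_vec y \<in> ?S" if "y \<notin> M'" "y \<in> X" for y
    proof -
      have "unit_vec y \<in> B" using that M'(2) by (auto simp: M_def)
      moreover have "(unit_vec y :: 'e \<Rightarrow>\<^sub>0 'k) \<noteq> unit_vec x"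
        using that x(1) inj_unit_vec by (auto dest: injD)
      ultimately show ?thesis by (intro pmvs.span_base) auto
    qed
    ultimately have "V \<union> unit_vec ` (- M') \<subseteq> ?S" by blast
    then have "pmvs.span (V \<union> unit_vec ` (- M')) \<subseteq> ?S"
      by (rule pmvs.span_minimal) simp
    then have "unit_vec x \<in> ?S"
      using M'(1) unfolding \<C>_def circuit_independent_iff_spanning by auto
    with B(3) xB show False unfolding pmvs.dependent_def by blast
  qed
  with IM M show ?thesis by (intro exI[of _ M]) (auto simp: M_def)
qed

theorem matroid_support_circuits:
  "matroid_circuits UNIV (support_circuits (annihilator V))"
  unfolding matroid_circuits_def
proof (intro conjI)
  let ?C = "support_circuits (annihilator V)"
  show "\<forall>C\<in>?C. \<forall>X D. X \<subseteq> C \<and> (\<forall>x\<in>X. D x \<in> ?C) \<and> (\<forall>x\<in>X. \<forall>y\<in>X. x \<in> D y \<longleftrightarrow> x = y) \<longrightarrow>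
        (\<forall>z \<in> C - (\<Union>x\<in>X. D x). \<exists>C'\<in>?C. z \<in> C' \<and> C' \<subseteq> (C \<union> (\<Union>x\<in>X. D x)) - X)"
  proof (intro ballI allI impI)
    fix C X D z
    assume *: "C \<in> ?C" "X \<subseteq> C \<and> (\<forall>x\<in>X. D x \<in> ?C) \<and> (\<forall>x\<in>X. \<forall>y\<in>X. x \<in> D y \<longleftrightarrow> x = y)"
      "z \<in> C - (\<Union>x\<in>X. D x)"
    show "\<exists>C'\<in>?C. z \<in> C' \<and> C' \<subseteq> (C \<union> (\<Union>x\<in>X. D x)) - X"
      using support_circuit_elimination[of C V X D z] * by metis
  qed
  show "\<forall>I X. I \<subseteq> X \<and> X \<subseteq> UNIV \<and> circuit_independent ?C I \<longrightarrow>
        (\<exists>M. circuit_independent ?C M \<and> I \<subseteq> M \<and> M \<subseteq> X \<and>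
           (\<forall>M'. circuit_independent ?C M' \<and> M \<subseteq> M' \<and> M' \<subseteq> X \<longrightarrow> M' = M))"
    using support_circuits_maximal_independent[of _ _ V] by blast
qed (auto simp: support_circuits_def)


section \<open>Scrawls are supports\<close>

text \<open>
  Over an uncountable field, countably many nonzero finite linear forms in countably many
  unknowns have a common non-root: the unknowns are chosen one at a time, and each choice only has
  to avoid the countably many values at which a form with that last unknown vanishes.
\<close>

lemma common_nonroot:
  fixes c :: "'x \<Rightarrow> 'b \<Rightarrow> 'k::field"
  assumes unc: "uncountable (UNIV :: 'k set)" and "countable X" "countable B"
    and fin: "\<And>x. x \<in> X \<Longrightarrow> finite {b. c x b \<noteq> 0}"
    and cB: "\<And>x b. x \<in> X \<Longrightarrow> c x b \<noteq> 0 \<Longrightarrow> b \<in> B"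
    and ne: "\<And>x. x \<in> X \<Longrightarrow> \<exists>b. c x b \<noteq> 0"
  obtains g where "\<And>x. x \<in> X \<Longrightarrow> (\<Sum>b | c x b \<noteq> 0. c x b * g b) \<noteq> 0"
proof -
  define h where "h = to_nat_on B"
  have inj: "inj_on h B" unfolding h_def by (rule inj_on_to_nat_on) fact
  define last where "last x b \<longleftrightarrow> c x b \<noteq> 0 \<and> (\<forall>b'. c x b' \<noteq> 0 \<longrightarrow> h b' \<le> h b)" for x b
  define rest where "rest g x b = (\<Sum>b' | c x b' \<noteq> 0 \<and> b' \<noteq> b. c x b' * g b')" for g x b
  define P where "P g b r \<longleftrightarrow> (\<forall>x\<in>X. last x b \<longrightarrow> c x b * r + rest g x b \<noteq> 0)" for g b r
  have "\<exists>g. \<forall>b. P g b (g b)"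
  proof (rule dependent_wf_choice)
    show "wf (inv_image less_than h)" by (simp add: wf_inv_image)
    fix g g' :: "'b \<Rightarrow> 'k" and b r
    assume eq: "g y = g' y" if "(y, b) \<in> inv_image less_than h" for y
    have "rest g x b = rest g' x b" if x: "x \<in> X" "last x b" for x
      unfolding rest_def
    proof (rule sum.cong[OF refl])
      fix b' assume b': "b' \<in> {b'. c x b' \<noteq> 0 \<and> b' \<noteq> b}"
      then have "h b' \<le> h b" using x by (auto simp: last_def)
      moreover have "h b' \<noteq> h b"
        using b' x cB[of x] inj by (auto simp: last_def inj_on_def)
      ultimately have "(b', b) \<in> inv_image less_than h" by simp
      from eq[OF this] show "c x b' * g b' = c x b' * g' b'" by simp
    qed
    then show "P g b r = P g' b r" by (auto simp: P_def)
  next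
    fix b and g :: "'b \<Rightarrow> 'k"
    \<comment> \<open>the values of \<open>g\<close> at \<open>b\<close> for which some form with last unknown \<open>b\<close> vanishes\<close>
    let ?bad = "(\<lambda>x. - rest g x b / c x b) ` X"
    have "countable ?bad" using \<open>countable X\<close> by simp
    with unc obtain r where r: "r \<notin> ?bad" by (metis UNIV_I countable_subset subsetI)
    have "P g b r" unfolding P_def
    proof (intro ballI impI notI)
      fix x assume x: "x \<in> X" "last x b" "c x b * r + rest g x b = 0"
      then have "c x b * r = - rest g x b" by (simp add: eq_neg_iff_add_eq_0)
      then have "r = - rest g x b / c x b"
        using x(2) by (simp add: last_def field_simps)
      with r x(1) show False by auto
    qed
    then show "\<exists>r. P g b r" ..
  qed
  then obtain g where g: "\<And>b. P g b (g b)" by blast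
  have "(\<Sum>b | c x b \<noteq> 0. c x b * g b) \<noteq> 0" if x: "x \<in> X" for x
  proof -
    let ?S = "{b. c x b \<noteq> 0}"
    have S: "finite ?S" "?S \<noteq> {}" using fin[OF x] ne[OF x] by auto
    then have "Max (h ` ?S) \<in> h ` ?S" by (intro Max_in) auto
    then obtain b where b: "b \<in> ?S" "h b = Max (h ` ?S)" by auto
    then have "last x b" using S by (auto simp: last_def)
    then have "c x b * g b + rest g x b \<noteq> 0" using g[of b] x by (auto simp: P_def)
    moreover have "(\<Sum>b'\<in>?S. c x b' * g b') = c x b * g b + (\<Sum>b'\<in>?S - {b}. c x b' * g b')"
      by (rule sum.remove[OF S(1) b(1)])
    moreover have "?S - {b} = {b'. c x b' \<noteq> 0 \<and> b' \<noteq> b}" by auto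
    ultimately show ?thesis by (simp add: rest_def)
  qed
  then show thesis by (rule that)
qed

text \<open>
  On a basis modulo the span of \<open>V\<close> and the unit vectors outside \<open>S\<close>, the values of a functional
  are free; each point of \<open>S\<close> gives a nonzero finite linear form in these values.
\<close>

lemma exists_support:
  fixes V :: "('e::countable \<Rightarrow>\<^sub>0 'k::field) set"
  assumes unc: "uncountable (UNIV :: 'k set)"
    and S: "\<And>z. z \<in> S \<Longrightarrow> unit_vec z \<notin> pmvs.span (V \<union> unit_vec ` (- S))"
  shows "S \<in> nonzeros ` annihilator V"
proof -
  let ?N = "V \<union> unit_vec ` (- S)"
  obtain B0 where B0: "B0 \<subseteq> ?N" "pmvs.independent B0" "?N \<subseteq> pmvs.span B0"
    using pmvs.maximal_independent_subset[of ?N] by blast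
  obtain B where B: "B0 \<subseteq> B" "B \<subseteq> B0 \<union> range unit_vec" "pmvs.independent B"
    "B0 \<union> range unit_vec \<subseteq> pmvs.span B"
    using pmvs.maximal_independent_subset_extend[of B0 "B0 \<union> range unit_vec"] B0(2) by blast
  let ?R = "pmvs.representation B"
  \<comment> \<open>the coordinates of \<open>unit_vec x\<close> modulo the span of \<open>?N\<close>, as a linear form in the values at
    \<open>B - B0\<close>\<close>
  define c where "c x b = (if b \<in> B0 then 0 else ?R (unit_vec x) b)" for x b
  have expand: "unit_vec x = (\<Sum>b | ?R (unit_vec x) b \<noteq> 0. pm_scale (?R (unit_vec x) b) b)" for x
    using B(3,4) by (subst pmvs.sum_nonzero_representation_eq) auto
  have "countable (B - B0)"
    by (rule countable_subset[of _ "range unit_vec"]) (use B(2) in auto)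
  obtain g where g: "\<And>x. x \<in> S \<Longrightarrow> (\<Sum>b | c x b \<noteq> 0. c x b * g b) \<noteq> 0"
  proof (rule common_nonroot[OF unc, of S "B - B0" c])
    show "finite {b. c x b \<noteq> 0}" for x
      by (rule finite_subset[OF _ pmvs.finite_representation[of B "unit_vec x"]])
         (auto simp: c_def split: if_splits)
    show "b \<in> B - B0" if "c x b \<noteq> 0" for x b
      using that pmvs.representation_ne_zero by (auto simp: c_def split: if_splits)
    show "\<exists>b. c x b \<noteq> 0" if "x \<in> S" for x
    proof (rule ccontr)
      assume *: "\<nexists>b. c x b \<noteq> 0"
      have "unit_vec x \<in> pmvs.span B0"
        by (subst expand, intro pmvs.span_sum pmvs.span_scale pmvs.span_base)
           (use * in \<open>auto simp: c_def split: if_splits\<close>)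
      also have "\<dots> \<subseteq> pmvs.span ?N" by (rule pmvs.span_mono[OF B0(1)])
      finally show False using S[OF that] by simp
    qed
  qed (use \<open>countable (B - B0)\<close> in auto)
  obtain f where f: "Vector_Spaces.linear pm_scale (*) f"
    and fB: "\<And>b. b \<in> B \<Longrightarrow> f b = (if b \<in> B0 then 0 else g b)"
    using pmvs_pair.linear_independent_extend[OF B(3), of "\<lambda>b. if b \<in> B0 then 0 else g b"]
    by blast
  interpret f: Vector_Spaces.linear pm_scale "(*)" f by (rule f)
  have f0: "f v = 0" if "v \<in> ?N" for v
    by (rule f.eq_0_on_span[of B0]) (use that B0 B(1) fB in auto)
  have "f (unit_vec x) \<noteq> 0" if "x \<in> S" for x
  proof -
    have "f (unit_vec x) = (\<Sum>b | ?R (unit_vec x) b \<noteq> 0. ?R (unit_vec x) b * f b)"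
      by (subst expand) (simp add: f.sum f.scale)
    also have "\<dots> = (\<Sum>b | c x b \<noteq> 0. c x b * g b)"
      using fB pmvs.representation_ne_zero[of B "unit_vec x"]
      by (intro sum.mono_neutral_cong_right pmvs.finite_representation)
         (auto simp: c_def split: if_splits)
    finally show ?thesis using g[OF that] by simp
  qed
  then have "nonzeros (\<lambda>x. f (unit_vec x)) = S"
    using f0 by (auto simp: nonzeros_def)
  with annihilatorI_linear[OF f, of V] f0 show ?thesis by blast
qed

theorem scrawls_support_circuits:
  fixes V :: "('e::countable \<Rightarrow>\<^sub>0 'k::field) set"
  assumes "uncountable (UNIV :: 'k set)"
  shows "scrawls (support_circuits (annihilator V)) = nonzeros ` annihilator V"
proof (intro equalityI subsetI)
  fix S assume "S \<in> scrawls (support_circuits (annihilator V))"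
  then obtain \<A> where A: "\<A> \<subseteq> support_circuits (annihilator V)" "S = \<Union>\<A>"
    by (auto simp: scrawls_def)
  show "S \<in> nonzeros ` annihilator V"
  proof (rule exists_support[OF assms])
    fix z assume "z \<in> S"
    then obtain C where C: "C \<in> \<A>" "z \<in> C" using A by auto
    then obtain w where w: "w \<in> annihilator V" "C = nonzeros w"
      using A(1) support_circuit_memE by blast
    show "unit_vec z \<notin> pmvs.span (V \<union> unit_vec ` (- S))"
      by (rule not_in_span_if_separated[OF w(1)]) (use C w A in \<open>auto simp: nonzeros_def\<close>)
  qed
next
  fix S assume "S \<in> nonzeros ` annihilator V"
  then obtain w where w: "w \<in> annihilator V" "S = nonzeros w" by auto
  have "\<exists>C \<in> support_circuits (annihilator V). z \<in> C \<and> C \<subseteq> S" if "z \<in> S" for z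
  proof -
    have "unit_vec z \<notin> pmvs.span (V \<union> unit_vec ` (- S))"
      by (rule not_in_span_if_separated[OF w(1)]) (use that w(2) in \<open>auto simp: nonzeros_def\<close>)
    then obtain C where "C \<in> support_circuits (annihilator V)" "z \<in> C" "C \<inter> (- S) = {}"
      by (rule support_circuit_avoiding)
    then show ?thesis by (intro bexI[of _ C]) auto
  qed
  then have "S = \<Union>{C \<in> support_circuits (annihilator V). C \<subseteq> S}" by blast
  then show "S \<in> scrawls (support_circuits (annihilator V))"
    unfolding scrawls_def
    by (intro CollectI exI[of _ "{C \<in> support_circuits (annihilator V). C \<subseteq> S}"] conjI) auto
qed


section \<open>Coefficients of iterated derivatives\<close>

text \<open>
  The product of the \<open>(N\<^sub>i + 1) \<cdots> (N\<^sub>i + J\<^sub>i)\<close>, the factor by which \<open>\<Theta>(J)\<close> multiplies the coefficient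
  that it moves from exponent \<open>N + J\<close> to \<open>N\<close>.
\<close>

definition theta_factor :: "nat ^ 'm::finite \<Rightarrow> nat ^ 'm \<Rightarrow> nat" where
  "theta_factor J N = (\<Prod>i\<in>UNIV. pochhammer (Suc (N $ i)) (J $ i))"

lemma theta_factor_neq_0 [simp]: "theta_factor J N \<noteq> 0"
  proof -
  have "0 < (\<Prod>i\<in>UNIV. pochhammer (Suc (N $ i)) (J $ i))"
    by (intro prod_pos ballI pochhammer_pos) simp
  then show ?thesis by (simp add: theta_factor_def)
qed

lemma vec_nat_induct [case_names zero step]:
  fixes J :: "nat ^ 'm::finite"
  assumes "P 0" "\<And>J i. P J \<Longrightarrow> P (J + axis i 1)"
  shows "P J"
proof (induction "\<Sum>i\<in>UNIV. J $ i" arbitrary: J)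
  case 0
  then have "J = 0" by (simp add: vec_eq_iff)
  with assms(1) show ?case by simp
next
  case (Suc n)
  then obtain i where i: "J $ i > 0"
    by (metis (mono_tags, lifting) gr0I nat.distinct(1) sum.neutral)
  let ?J = "J - axis i 1"
  have J: "?J + axis i 1 = J" using i by (auto simp: vec_eq_iff axis_def)
  have "(\<Sum>k\<in>UNIV. J $ k) = (\<Sum>k\<in>UNIV. ?J $ k) + (\<Sum>k\<in>UNIV. axis i 1 $ k)"
    by (subst J[symmetric]) (simp add: sum.distrib del: vector_minus_component)
  also have "(\<Sum>k\<in>UNIV. axis i (1 :: nat) $ k) = 1" by (simp add: axis_def)
  finally have "n = (\<Sum>k\<in>UNIV. ?J $ k)" using Suc(2) by simp
  from assms(2)[OF Suc(1)[OF this], of i] show ?case by (simp only: J)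
qed

lemma theta_factor_add_axis:
  "theta_factor (J + axis i 1) N = (N $ i + 1) * theta_factor J (N + axis i 1)"
proof -
  have "theta_factor (J + axis i 1) N = pochhammer (Suc (N $ i)) (Suc (J $ i)) *
      (\<Prod>k\<in>UNIV - {i}. pochhammer (Suc (N $ k)) ((J + axis i 1) $ k))"
    unfolding theta_factor_def by (subst prod.remove[of _ i]) (auto simp: axis_def)
  also have "pochhammer (Suc (N $ i)) (Suc (J $ i)) =
      (N $ i + 1) * pochhammer (Suc ((N + axis i 1) $ i)) (J $ i)"
    by (simp add: pochhammer_rec axis_def)
  also have "(\<Prod>k\<in>UNIV - {i}. pochhammer (Suc (N $ k)) ((J + axis i 1) $ k)) =
      (\<Prod>k\<in>UNIV - {i}. pochhammer (Suc ((N + axis i 1) $ k)) (J $ k))"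
    by (rule prod.cong) (auto simp: axis_def)
  also have "(N $ i + 1) * pochhammer (Suc ((N + axis i 1) $ i)) (J $ i) *
      (\<Prod>k\<in>UNIV - {i}. pochhammer (Suc ((N + axis i 1) $ k)) (J $ k)) =
      (N $ i + 1) * theta_factor J (N + axis i 1)"
    unfolding theta_factor_def mult.assoc by (subst (2) prod.remove[of _ i]) simp_all
  finally show ?thesis .
qed

lemma Theta_0 [simp]: "Theta 0 f = f"
  by (rule iter_deriv_0) (rule mfps_deriv_commute)

lemma Theta_add_axis: "Theta (J + axis i 1) f = mfps_deriv i (Theta J f)"
  by (rule iter_deriv_add_axis) (rule mfps_deriv_commute)

lemma coeff_Theta:
  "coeff (Theta J f) N = of_nat (theta_factor J N) * coeff f (N + J)"
proof (induction J arbitrary: N rule: vec_nat_induct)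
  case zero
  then show ?case by (simp add: theta_factor_def)
next
  case (step J i)
  have "coeff (Theta (J + axis i 1) f) N =
      of_nat (N $ i + 1) * coeff (Theta J f) (N + axis i 1)"
    by (simp only: Theta_add_axis coeff_mfps_deriv)
  also have "\<dots> = of_nat ((N $ i + 1) * theta_factor J (N + axis i 1)) * coeff f (N + (J + axis i 1))"
    by (simp only: step of_nat_mult mult.assoc add.assoc add.commute[of J])
  finally show ?case by (simp only: theta_factor_add_axis)
qed


section \<open>Evaluation of differential polynomials\<close>

lemma eval_mono_superset:
  assumes "finite A" "Poly_Mapping.keys M \<subseteq> A"
  shows "eval_mono M \<phi> = (\<Prod>v\<in>A. Theta (snd v) (\<phi> (fst v)) ^ Poly_Mapping.lookup M v)"
  unfolding eval_mono_def case_prod_unfold prod.collapse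
  by (rule prod.mono_neutral_left) (use assms in \<open>auto simp: not_in_keys_iff_lookup_eq_zero\<close>)

lemma eval_mono_0 [simp]: "eval_mono 0 \<phi> = 1"
  by (simp add: eval_mono_def)

lemma eval_mono_single [simp]: "eval_mono (Poly_Mapping.single (i, J) 1) \<phi> = Theta J (\<phi> i)"
  by (simp add: eval_mono_def)

lemma eval_mono_add: "eval_mono (M + N) \<phi> = eval_mono M \<phi> * eval_mono N \<phi>"
proof -
  let ?A = "Poly_Mapping.keys M \<union> Poly_Mapping.keys N"
  have "Poly_Mapping.keys (M + N) \<subseteq> ?A" by (rule Poly_Mapping.keys_add)
  then show ?thesis
    by (simp add: eval_mono_superset[of ?A] lookup_add power_add prod.distrib)
qed

lemma eval_poly_superset:
  assumes "finite A" "Poly_Mapping.keys P \<subseteq> A"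
  shows "eval_poly P \<phi> = (\<Sum>M\<in>A. Poly_Mapping.lookup P M * eval_mono M \<phi>)"
  unfolding eval_poly_def
  by (rule sum.mono_neutral_left) (use assms in \<open>auto simp: not_in_keys_iff_lookup_eq_zero\<close>)

lemma eval_poly_0 [simp]: "eval_poly 0 \<phi> = 0"
  by (simp add: eval_poly_def)

lemma eval_poly_single: "eval_poly (Poly_Mapping.single M a) \<phi> = a * eval_mono M \<phi>"
  by (subst eval_poly_superset[of "{M}"]) auto

lemma eval_poly_add: "eval_poly (P + Q) \<phi> = eval_poly P \<phi> + eval_poly Q \<phi>"
proof -
  let ?A = "Poly_Mapping.keys P \<union> Poly_Mapping.keys Q"
  have "Poly_Mapping.keys (P + Q) \<subseteq> ?A" by (rule Poly_Mapping.keys_add)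
  then show ?thesis
    by (simp add: eval_poly_superset[of ?A] lookup_add distrib_right sum.distrib)
qed

lemma eval_poly_mult: "eval_poly (P * Q) \<phi> = eval_poly P \<phi> * eval_poly Q \<phi>"
proof (induction P rule: poly_mapping_additive_induct)
  case (single M a)
  show ?case
  proof (induction Q rule: poly_mapping_additive_induct)
    case (single N b)
    show ?case by (simp add: mult_single eval_poly_single eval_mono_add ac_simps)
  next
    case (add f g)
    then show ?case by (simp add: eval_poly_add distrib_left)
  qed simp
next
  case (add f g)
  then show ?case by (simp add: eval_poly_add distrib_right)
qed simp

lemma eval_poly_deriv:
  fixes P :: "('a::comm_semiring_1, 'm::finite, 'n) dpoly"
  shows "eval_poly (dpoly_deriv i P) \<phi> = mfps_deriv i (eval_poly P \<phi>)"
proof -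
  define C where "C P \<longleftrightarrow> eval_poly (dpoly_deriv i P) \<phi> = mfps_deriv i (eval_poly P \<phi>)"
    for P :: "('a, 'm, 'n) dpoly"
  have C_mult: "C (P * Q)" if "C P" "C Q" for P Q
    using that by (simp add: C_def dpoly_deriv_mult eval_poly_add eval_poly_mult mfps_deriv_mult)
  have C_var: "C (var_poly v)" for v
  proof -
    obtain k J where v: "v = (k, J)" by (cases v)
    have "eval_poly (var_poly (k, L)) \<phi> = Theta L (\<phi> k)" for L
      unfolding var_poly_def eval_poly_single eval_mono_single by simp
    then show ?thesis
      unfolding v C_def dpoly_deriv_var by (simp only: Theta_add_axis)
  qed
  have C_const: "C (Poly_Mapping.single 0 a)" for a
    by (simp add: C_def dpoly_deriv_const[unfolded const_poly_def] eval_poly_single)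
  have C_mono: "C (Poly_Mapping.single M 1)" for M
  proof (induction M rule: poly_mapping_additive_induct)
    case (single v n)
    show ?case
    proof (induction n)
      case (Suc n)
      have "Poly_Mapping.single (Poly_Mapping.single v (Suc n)) (1 :: ('a, 'm) mfps)
          = var_poly v * Poly_Mapping.single (Poly_Mapping.single v n) 1"
        by (simp add: var_poly_def mult_single flip: Poly_Mapping.single_add)
      with C_mult[OF C_var Suc] show ?case by metis
    qed (use C_const[of 1] in simp)
  next
    case (add M N)
    from C_mult[OF this] show ?case by (simp add: mult_single)
  qed (use C_const[of 1] in simp)
  have "C P"
  proof (induction P rule: poly_mapping_additive_induct)
    case (single M a)
    from C_mult[OF C_const[of a] C_mono[of M]] show ?case
      by (simp add: mult_single)
  qed (simp_all add: C_def dpoly_deriv_add eval_poly_add mfps_deriv_add)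
  then show ?thesis by (simp add: C_def)
qed

lemma iter_dpoly_deriv_0: "iter_deriv dpoly_deriv 0 P = P"
  by (rule iter_deriv_0) (rule dpoly_deriv_commute)

lemma iter_dpoly_deriv_add_axis:
  "iter_deriv dpoly_deriv (J + axis i 1) P = dpoly_deriv i (iter_deriv dpoly_deriv J P)"
  by (rule iter_deriv_add_axis) (rule dpoly_deriv_commute)

lemma eval_poly_iter_deriv: "eval_poly (iter_deriv dpoly_deriv J P) \<phi> = Theta J (eval_poly P \<phi>)"
  by (induction J rule: vec_nat_induct)
     (simp_all only: iter_dpoly_deriv_0 Theta_0 iter_dpoly_deriv_add_axis Theta_add_axis eval_poly_deriv)


section \<open>Differential ideals and their solutions\<close>

lemma differential_ideal_diff_ideal_of: "differential_ideal (diff_ideal_of \<Sigma>)"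
  unfolding diff_ideal_of_def
  by (rule hull_in) (auto simp: differential_ideal_def)

lemma subset_diff_ideal_of: "\<Sigma> \<subseteq> diff_ideal_of \<Sigma>"
  unfolding diff_ideal_of_def by (rule hull_subset)

lemma diff_ideal_of_vanishes:
  assumes "\<phi> \<in> Sol \<Sigma>" "P \<in> diff_ideal_of \<Sigma>"
  shows "eval_poly P \<phi> = 0"
proof -
  have "differential_ideal {P. eval_poly P \<phi> = 0}"
    by (auto simp: differential_ideal_def eval_poly_add eval_poly_mult eval_poly_deriv)
  moreover have "\<Sigma> \<subseteq> {P. eval_poly P \<phi> = 0}" using assms(1) by (auto simp: Sol_def)
  ultimately have "diff_ideal_of \<Sigma> \<subseteq> {P. eval_poly P \<phi> = 0}"
    unfolding diff_ideal_of_def by (intro hull_minimal)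
  with assms(2) show ?thesis by auto
qed

lemma dpoly_deriv_in_diff_ideal_of: "P \<in> diff_ideal_of \<Sigma> \<Longrightarrow> dpoly_deriv i P \<in> diff_ideal_of \<Sigma>"
  using differential_ideal_diff_ideal_of[of \<Sigma>] by (simp add: differential_ideal_def)

lemma iter_deriv_in_diff_ideal_of:
  "P \<in> diff_ideal_of \<Sigma> \<Longrightarrow> iter_deriv dpoly_deriv J P \<in> diff_ideal_of \<Sigma>"
  by (induction J rule: vec_nat_induct)
     (simp_all only: iter_dpoly_deriv_0 iter_dpoly_deriv_add_axis dpoly_deriv_in_diff_ideal_of)

lemma linear_homogeneous_0: "linear_homogeneous 0"
  by (simp add: linear_homogeneous_def)

lemma linear_homogeneous_add:
  "linear_homogeneous P \<Longrightarrow> linear_homogeneous Q \<Longrightarrow> linear_homogeneous (P + Q)"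
  using Poly_Mapping.keys_add[of P Q] by (auto simp: linear_homogeneous_def)

lemma linear_homogeneous_sum:
  "(\<And>x. x \<in> A \<Longrightarrow> linear_homogeneous (f x)) \<Longrightarrow> linear_homogeneous (sum f A)"
  by (induction A rule: infinite_finite_induct)
     (auto intro: linear_homogeneous_0 linear_homogeneous_add)

lemma linear_homogeneous_single: "linear_homogeneous (Poly_Mapping.single (Poly_Mapping.single v 1) a)"
  by (auto simp: linear_homogeneous_def simp del: split_paired_Ex split: if_splits)

lemma linear_homogeneous_deriv:
  assumes "linear_homogeneous P"
  shows "linear_homogeneous (dpoly_deriv i P)"
  unfolding dpoly_deriv_def
proof (rule linear_homogeneous_sum)
  fix M assume "M \<in> Poly_Mapping.keys P"
  then obtain v where M: "M = Poly_Mapping.single v 1"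
    using assms by (auto simp: linear_homogeneous_def)
  have "dterm_deriv i M a = Poly_Mapping.single (Poly_Mapping.single v 1) (mfps_deriv i a) +
      Poly_Mapping.single (Poly_Mapping.single (fst v, snd v + axis i 1) 1) a" for a
    by (simp add: dterm_deriv_def M case_prod_unfold)
  then show "linear_homogeneous (dterm_deriv i M (Poly_Mapping.lookup P M))"
    by (metis linear_homogeneous_add linear_homogeneous_single)
qed

lemma linear_homogeneous_iter_deriv:
  "linear_homogeneous P \<Longrightarrow> linear_homogeneous (iter_deriv dpoly_deriv J P)"
  by (induction J rule: vec_nat_induct)
     (simp_all only: iter_dpoly_deriv_0 iter_dpoly_deriv_add_axis linear_homogeneous_deriv)


section \<open>Solution spaces as annihilators\<close>

text \<open>The coefficients of a tuple of power series, indexed like the differential variables.\<close>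

definition coords :: "('n \<Rightarrow> ('a::zero, 'm::finite) mfps) \<Rightarrow> ('m, 'n) dvar \<Rightarrow> 'a" where
  "coords \<phi> v = coeff (\<phi> (fst v)) (snd v)"

text \<open>
  For a linear form \<open>Q\<close>, the constant term of \<open>Q(\<phi>)\<close> as a functional of the coefficients of \<open>\<phi>\<close>.
  For other \<open>Q\<close> only the linear terms are taken into account.
\<close>

lift_definition const_term_functional ::
  "('k::field, 'm::finite, 'n) dpoly \<Rightarrow> ('m, 'n) dvar \<Rightarrow>\<^sub>0 'k" is
  "\<lambda>Q v. coeff (Q (Poly_Mapping.single v 1)) 0 * of_nat (theta_factor (snd v) 0)"
proof -
  fix Q :: "('m, 'n) dmono \<Rightarrow> ('k, 'm) mfps"
  assume fin: "finite {M. Q M \<noteq> 0}"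
  have inj: "inj (\<lambda>v :: ('m, 'n) dvar. Poly_Mapping.single v (1 :: nat))"
    by (rule injI) (metis lookup_single_eq lookup_single_not_eq zero_neq_one)
  show "finite {v. coeff (Q (Poly_Mapping.single v 1)) 0 * of_nat (theta_factor (snd v) 0) \<noteq> 0}"
    by (rule finite_subset[OF _ finite_vimageI[OF fin inj]]) auto
qed

lemma coeff_mult_0: "coeff (f * g) 0 = coeff f 0 * coeff g 0"
proof -
  have "splits (0 :: nat ^ 'b::finite) = {(0, 0)}" by (auto simp: splits_def)
  then show ?thesis by (simp add: coeff_mult)
qed

lemma coeff_sum: "coeff (sum f A) N = (\<Sum>x\<in>A. coeff (f x) N)"
  by (induction A rule: infinite_finite_induct) auto

lemma pairing_const_term_functional:
  fixes Q :: "('k::field, 'm::finite, 'n) dpoly"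
  assumes "linear_homogeneous Q"
  shows "pairing (coords \<phi>) (const_term_functional Q) = coeff (eval_poly Q \<phi>) 0"
proof -
  define A where "A = {v. Poly_Mapping.single v 1 \<in> Poly_Mapping.keys Q}"
  have inj: "inj (\<lambda>v :: ('m, 'n) dvar. Poly_Mapping.single v (1 :: nat))"
    by (rule injI) (metis lookup_single_eq lookup_single_not_eq zero_neq_one)
  have A: "finite A" unfolding A_def
    by (rule finite_subset[OF _ finite_vimageI[OF finite_keys[of Q] inj]]) auto
  have keys: "Poly_Mapping.keys Q = (\<lambda>v. Poly_Mapping.single v 1) ` A"
    using assms by (auto simp: A_def linear_homogeneous_def)
  have "pairing (coords \<phi>) (const_term_functional Q) =
      (\<Sum>v\<in>A. Poly_Mapping.lookup (const_term_functional Q) v * coords \<phi> v)"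
    by (rule pairing_superset[OF A])
       (auto simp: A_def in_keys_iff const_term_functional.rep_eq)
  also have "\<dots> = (\<Sum>v\<in>A. coeff (Poly_Mapping.lookup Q (Poly_Mapping.single v 1) *
      eval_mono (Poly_Mapping.single v 1) \<phi>) 0)"
  proof (rule sum.cong[OF refl])
    fix v :: "('m, 'n) dvar"
    show "Poly_Mapping.lookup (const_term_functional Q) v * coords \<phi> v =
      coeff (Poly_Mapping.lookup Q (Poly_Mapping.single v 1) * eval_mono (Poly_Mapping.single v 1) \<phi>) 0"
      by (cases v) (simp add: const_term_functional.rep_eq coords_def coeff_mult_0 coeff_Theta
          mult.assoc del: One_nat_def flip: One_nat_def)
  qed
  also have "\<dots> = coeff (eval_poly Q \<phi>) 0"
    unfolding eval_poly_def keys coeff_sum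
    by (subst sum.reindex) (use inj in \<open>auto simp: inj_on_def dest: injD\<close>)
  finally show ?thesis .
qed

text \<open>The space \<open>V\<close> whose annihilator is the solution space.\<close>

definition const_term_functionals ::
  "('k::field, 'm::finite, 'n) dpoly set \<Rightarrow> (('m, 'n) dvar \<Rightarrow>\<^sub>0 'k) set" where
  "const_term_functionals \<Sigma> = const_term_functional ` {Q \<in> diff_ideal_of \<Sigma>. linear_homogeneous Q}"

lemma const_term_functionalsI:
  "Q \<in> diff_ideal_of \<Sigma> \<Longrightarrow> linear_homogeneous Q \<Longrightarrow> const_term_functional Q \<in> const_term_functionals \<Sigma>"
  by (auto simp: const_term_functionals_def)

lemma subspace_const_term_functionals:
  fixes \<Sigma> :: "('k::field, 'm::finite, 'n) dpoly set"
  shows "pmvs.subspace (const_term_functionals \<Sigma>)"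
proof (rule pmvs.subspaceI)
  let ?L = "{Q \<in> diff_ideal_of \<Sigma>. linear_homogeneous Q}"
  note ideal = differential_ideal_diff_ideal_of[of \<Sigma>, unfolded differential_ideal_def]
  have "const_term_functional (0 :: ('k, 'm, 'n) dpoly) = 0"
    by (rule poly_mapping_eqI) (simp add: const_term_functional.rep_eq)
  then show "0 \<in> const_term_functionals \<Sigma>"
    using const_term_functionalsI[of 0 \<Sigma>] ideal by (simp add: linear_homogeneous_0)
  fix x y assume "x \<in> const_term_functionals \<Sigma>" "y \<in> const_term_functionals \<Sigma>"
  then obtain P Q where P: "P \<in> ?L" "x = const_term_functional P"
    and Q: "Q \<in> ?L" "y = const_term_functional Q"
    unfolding const_term_functionals_def by blast
  have "x + y = const_term_functional (P + Q)"
    unfolding P Q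
    by (rule poly_mapping_eqI) (simp add: const_term_functional.rep_eq lookup_add distrib_right)
  moreover have "P + Q \<in> ?L"
    using P Q ideal by (auto intro: linear_homogeneous_add)
  ultimately show "x + y \<in> const_term_functionals \<Sigma>"
    by (simp add: const_term_functionalsI)
  fix c
  define a :: "('k, 'm) mfps" where "a = Abs_mfps (\<lambda>N. if N = 0 then c else 0)"
  have a: "coeff a 0 = c" by (simp add: a_def Abs_mfps_inverse)
  have lookup: "Poly_Mapping.lookup (const_poly a * P) M = a * Poly_Mapping.lookup P M" for M
    by (induction P rule: poly_mapping_additive_induct)
       (auto simp: const_poly_def mult_single lookup_single when_def distrib_left lookup_add)
  have "pm_scale c x = const_term_functional (const_poly a * P)"
    unfolding P
    by (rule poly_mapping_eqI)
       (simp add: const_term_functional.rep_eq lookup coeff_mult_0 a mult.assoc)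
  moreover have "const_poly a * P \<in> ?L"
    using P ideal by (auto simp: linear_homogeneous_def in_keys_iff lookup)
  ultimately show "pm_scale c x \<in> const_term_functionals \<Sigma>"
    by (simp add: const_term_functionalsI)
qed

text \<open>
  The coefficient of \<open>P(\<phi>)\<close> at \<open>N\<close> is, up to a nonzero integer factor, the constant term of
  \<open>(\<Theta>(N)P)(\<phi>)\<close>, and \<open>\<Theta>(N)P\<close> is again a linear form in the ideal.
\<close>

lemma Sol_iff_annihilator:
  fixes \<Sigma> :: "('k::field_char_0, 'm::finite, 'n) dpoly set"
  assumes "\<forall>P\<in>\<Sigma>. linear_homogeneous P"
  shows "\<phi> \<in> Sol \<Sigma> \<longleftrightarrow> coords \<phi> \<in> annihilator (const_term_functionals \<Sigma>)"
proof
  assume "\<phi> \<in> Sol \<Sigma>"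
  then show "coords \<phi> \<in> annihilator (const_term_functionals \<Sigma>)"
    by (auto simp: annihilator_def const_term_functionals_def pairing_const_term_functional
        diff_ideal_of_vanishes)
next
  assume ann: "coords \<phi> \<in> annihilator (const_term_functionals \<Sigma>)"
  have "eval_poly P \<phi> = 0" if P: "P \<in> \<Sigma>" for P
  proof (rule mfps_eqI)
    fix N
    let ?Q = "iter_deriv dpoly_deriv N P"
    have lin: "linear_homogeneous ?Q"
      using P assms by (simp add: linear_homogeneous_iter_deriv)
    moreover have "?Q \<in> diff_ideal_of \<Sigma>"
      using P subset_diff_ideal_of iter_deriv_in_diff_ideal_of by blast
    ultimately have "const_term_functional ?Q \<in> const_term_functionals \<Sigma>"
      by (auto simp: const_term_functionals_def)
    then have "coeff (eval_poly ?Q \<phi>) 0 = 0"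
      using ann by (auto simp: annihilator_def pairing_const_term_functional[OF lin])
    then show "coeff (eval_poly P \<phi>) N = coeff 0 N"
      by (simp add: eval_poly_iter_deriv coeff_Theta)
  qed
  then show "\<phi> \<in> Sol \<Sigma>" by (simp add: Sol_def)
qed

lemma nonzeros_coords: "nonzeros (coords \<phi>) = flatten (\<lambda>i. supp (\<phi> i))"
  by (auto simp: nonzeros_def coords_def flatten_def supp_def)

lemma flatten_le_iff: "flatten S \<subseteq> flatten T \<longleftrightarrow> S \<le> T"
  by (force simp: flatten_def le_fun_def)

lemma flatten_eq_iff: "flatten S = flatten T \<longleftrightarrow> S = T"
  using flatten_le_iff[of S T] flatten_le_iff[of T S] by (auto intro: antisym)

lemma flatten_supports_Sol:
  fixes \<Sigma> :: "('k::field_char_0, 'm::finite, 'n) dpoly set"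
  assumes "\<forall>P\<in>\<Sigma>. linear_homogeneous P"
  shows "flatten ` supports (Sol \<Sigma>) = nonzeros ` annihilator (const_term_functionals \<Sigma>)"
proof -
  have "w \<in> coords ` Sol \<Sigma>" if "w \<in> annihilator (const_term_functionals \<Sigma>)" for w
  proof -
    define \<phi> where "\<phi> i = Abs_mfps (\<lambda>J. w (i, J))" for i
    have "coords \<phi> = w" by (auto simp: coords_def \<phi>_def Abs_mfps_inverse)
    with that show ?thesis using Sol_iff_annihilator[OF assms, of \<phi>] by auto
  qed
  then have "annihilator (const_term_functionals \<Sigma>) = coords ` Sol \<Sigma>"
    using Sol_iff_annihilator[OF assms] by auto
  then show ?thesis
    by (auto simp: supports_def image_image nonzeros_coords)
qed

lemma flatten_minimal_supports:
  fixes \<Sigma> :: "('k::field_char_0, 'm::finite, 'n) dpoly set"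
  assumes "\<forall>P\<in>\<Sigma>. linear_homogeneous P"
  shows "flatten ` minimal_supports (Sol \<Sigma>) =
    support_circuits (annihilator (const_term_functionals \<Sigma>))"
proof -
  let ?A = "supports (Sol \<Sigma>) - {\<lambda>_. {}}"
  have "inj (flatten :: ('n \<Rightarrow> (nat ^ 'm) set) \<Rightarrow> _)"
    by (rule injI) (simp add: flatten_eq_iff)
  then have "flatten ` ?A = nonzeros ` annihilator (const_term_functionals \<Sigma>) - {flatten (\<lambda>_. {})}"
    by (simp add: image_set_diff flatten_supports_Sol[OF assms])
  moreover have "flatten (\<lambda>_ :: 'n. {} :: (nat ^ 'm) set) = {}" by (simp add: flatten_def)
  ultimately have "support_circuits (annihilator (const_term_functionals \<Sigma>)) =
      {C \<in> flatten ` ?A. \<forall>C'\<in>flatten ` ?A. C' \<subseteq> C \<longrightarrow> C' = C}"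
    by (simp add: support_circuits_def)
  also have "\<dots> = flatten ` {S \<in> ?A. \<forall>S'\<in>?A. S' \<le> S \<longrightarrow> S' = S}"
  proof -
    have "{C \<in> flatten ` B. Q C} = flatten ` {S \<in> B. Q (flatten S)}" for B Q by auto
    from this[of ?A "\<lambda>C. \<forall>C'\<in>flatten ` ?A. C' \<subseteq> C \<longrightarrow> C' = C"]
    show ?thesis by (simp only: ball_simps flatten_le_iff flatten_eq_iff)
  qed
  finally show ?thesis by (simp add: minimal_supports_def)
qed


section \<open>Newton polyhedra and supporting weights\<close>

lemma dickson_coordinates:
  fixes A :: "(nat ^ 'm) set"
  assumes "finite I"
  shows "\<exists>B\<subseteq>A. finite B \<and> (\<forall>a\<in>A. \<exists>b\<in>B. \<forall>i\<in>I. b $ i \<le> a $ i)"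
  using assms
proof (induction I arbitrary: A)
  case empty
  show ?case
  proof (cases "A = {}")
    case False
    then obtain a where "a \<in> A" by auto
    then show ?thesis by (intro exI[of _ "{a}"]) auto
  qed auto
next
  case (insert j I)
  obtain B where B: "B \<subseteq> A" "finite B" "\<And>a. a \<in> A \<Longrightarrow> \<exists>b\<in>B. \<forall>i\<in>I. b $ i \<le> a $ i"
    using insert.IH[of A] by blast
  have "\<forall>n. \<exists>B'\<subseteq>{a \<in> A. a $ j = n}. finite B' \<and> (\<forall>a\<in>{a \<in> A. a $ j = n}. \<exists>b\<in>B'. \<forall>i\<in>I. b $ i \<le> a $ i)"
    using insert.IH by blast
  from choice[OF this] obtain F where "\<forall>n. F n \<subseteq> {a \<in> A. a $ j = n} \<and> finite (F n) \<and>
      (\<forall>a\<in>{a \<in> A. a $ j = n}. \<exists>b\<in>F n. \<forall>i\<in>I. b $ i \<le> a $ i)" ..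
  then have F: "\<And>n. F n \<subseteq> {a \<in> A. a $ j = n}" "\<And>n. finite (F n)"
    "\<And>n a. a \<in> A \<Longrightarrow> a $ j = n \<Longrightarrow> \<exists>b\<in>F n. \<forall>i\<in>I. b $ i \<le> a $ i"
    by blast+
  \<comment> \<open>an upper bound for the \<open>j\<close>-th coordinates in \<open>B\<close>: above it \<open>B\<close> suffices, below it the finitely
    many slices do\<close>
  define N where "N = (\<Sum>b\<in>B. b $ j)"
  let ?B = "B \<union> (\<Union>n\<le>N. F n)"
  have "\<exists>b\<in>?B. \<forall>i\<in>insert j I. b $ i \<le> a $ i" if a: "a \<in> A" for a
  proof (cases "a $ j \<le> N")
    case True
    obtain b where "b \<in> F (a $ j)" "\<forall>i\<in>I. b $ i \<le> a $ i" using F(3)[OF a refl] by blast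
    moreover have "b $ j = a $ j" using F(1) \<open>b \<in> F (a $ j)\<close> by blast
    ultimately show ?thesis using True by (intro bexI[of _ b]) auto
  next
    case False
    obtain b where b: "b \<in> B" "\<forall>i\<in>I. b $ i \<le> a $ i" using B(3)[OF a] by blast
    have "b $ j \<le> N" unfolding N_def by (rule member_le_sum) (use b B in auto)
    then show ?thesis using b False by (intro bexI[of _ b]) auto
  qed
  moreover have "?B \<subseteq> A" using B(1) F(1) by blast
  moreover have "finite ?B" using B(2) F(2) by blast
  ultimately show ?case by blast
qed

lemma dickson:
  fixes A :: "(nat ^ 'm::finite) set"
  obtains B where "B \<subseteq> A" "finite B" "\<And>a. a \<in> A \<Longrightarrow> \<exists>b\<in>B. \<forall>i. b $ i \<le> a $ i"
  using dickson_coordinates[of UNIV A] by auto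

lemma real_vec_add: "real_vec (a + b) = real_vec a + real_vec b"
  by (simp add: real_vec_def vec_eq_iff)

lemma real_vec_0 [simp]: "real_vec 0 = 0"
  by (simp add: real_vec_def vec_eq_iff)

lemma real_vec_in_newton: "a \<in> A \<Longrightarrow> real_vec (a + b) \<in> newton A"
  unfolding newton_def by (rule hull_inc) auto

lemma newton_mono: "A \<subseteq> B \<Longrightarrow> newton A \<subseteq> newton B"
  unfolding newton_def by (rule hull_mono) auto

lemma newton_add_newton_0:
  assumes "x \<in> newton A" "y \<in> newton {0}"
  shows "x + y \<in> newton A"
proof -
  have "x + y \<in> newton (A + {0})"
    unfolding newton_plus using assms by (rule set_plus_intro)
  then show ?thesis by (simp add: set_plus_def)
qed

text \<open>The Newton polyhedron of the exponent \<open>0\<close> contains the whole real nonnegative orthant.\<close>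

lemma nonneg_in_newton_0:
  fixes d :: "real ^ 'm::finite"
  assumes d: "\<And>i. 0 \<le> d $ i"
  shows "d \<in> newton {0}"
proof -
  have zero: "0 \<in> newton {0 :: nat ^ 'm}"
    using real_vec_in_newton[of 0 "{0}" 0] by simp
  have scaled: "axis i t \<in> newton {0}" if "0 \<le> t" for i :: 'm and t :: real
  proof -
    obtain n :: nat where n: "t < real n" using reals_Archimedean2 by blast
    then have "real n > 0" using that by linarith
    have "real_vec (axis i n) \<in> newton {0 :: nat ^ 'm}"
      using real_vec_in_newton[of 0 "{0}" "axis i n"] by simp
    then have "(1 - t / n) *\<^sub>R 0 + (t / n) *\<^sub>R real_vec (axis i n) \<in> newton {0 :: nat ^ 'm}"
      using zero that n \<open>real n > 0\<close>
      unfolding newton_def by (intro convexD convex_convex_hull) (auto simp: field_simps)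
    moreover have "(1 - t / n) *\<^sub>R 0 + (t / n) *\<^sub>R real_vec (axis i n) = axis i t"
      using \<open>real n > 0\<close> by (auto simp: real_vec_def vec_eq_iff axis_def)
    ultimately show ?thesis by simp
  qed
  have "(\<Sum>i\<in>I. axis i (d $ i)) \<in> newton {0 :: nat ^ 'm}" if "finite I" for I
    using that
  proof induction
    case (insert i I)
    have "axis i (d $ i) \<in> newton {0}" by (rule scaled[OF d])
    from newton_add_newton_0[OF this insert.IH] show ?case using insert.hyps by simp
  qed (use zero in simp)
  from this[of UNIV] have "(\<Sum>i\<in>UNIV. axis i (d $ i)) \<in> newton {0 :: nat ^ 'm}" by simp
  moreover have "(\<Sum>i\<in>UNIV. axis i (d $ i)) = d"
    by (simp add: vec_eq_iff axis_def)
  ultimately show ?thesis by simp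
qed

text \<open>
  A point outside a Newton polyhedron is cut off by a weight vector with nonnegative entries. By
  Dickson's lemma the polyhedron is the sum of a polytope and the orthant, hence closed.
\<close>

lemma newton_separation:
  fixes R :: "(nat ^ 'm::finite) set"
  assumes a: "real_vec a \<notin> newton R"
  obtains \<omega> :: "real ^ 'm" where "\<And>i. 0 \<le> \<omega> $ i"
    "\<And>r. r \<in> R \<Longrightarrow> \<omega> \<bullet> real_vec a < \<omega> \<bullet> real_vec r"
proof (cases "R = {}")
  case True
  then show thesis by (intro that[of 0]) auto
next
  case False
  obtain B where B: "B \<subseteq> R" "finite B" "\<And>r. r \<in> R \<Longrightarrow> \<exists>b\<in>B. \<forall>i. b $ i \<le> r $ i"
    by (rule dickson[of R]) blast
  define D where "D = {x :: real ^ 'm. \<forall>i. 0 \<le> x $ i}"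
  define P where "P = (\<Union>x\<in>convex hull (real_vec ` B). \<Union>y\<in>D. {x + y})"
  have "convex D" unfolding D_def convex_def by auto
  then have "convex P" unfolding P_def by (intro convex_sums) auto
  have "closed D"
    unfolding D_def by (intro closed_Collect_all closed_Collect_le continuous_intros)
  then have "closed P"
    unfolding P_def
    by (intro compact_closed_sums) (use B(2) in \<open>auto intro: finite_imp_compact_convex_hull\<close>)
  have "P \<subseteq> newton R"
  proof
    fix p assume "p \<in> P"
    then obtain x y where p: "x \<in> convex hull (real_vec ` B)" "y \<in> D" "p = x + y"
      by (auto simp: P_def)
    have "real_vec ` B \<subseteq> {real_vec (I + J) |I J. I \<in> R}"
    proof
      fix v assume "v \<in> real_vec ` B"
      then obtain b where "b \<in> R" "v = real_vec (b + 0)" using B(1) by auto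
      then show "v \<in> {real_vec (I + J) |I J. I \<in> R}" by blast
    qed
    then have "x \<in> newton R"
      unfolding newton_def by (rule subsetD[OF hull_mono p(1)])
    moreover have "y \<in> newton {0}"
      using p(2) by (intro nonneg_in_newton_0) (auto simp: D_def)
    ultimately show "p \<in> newton R" unfolding p(3) by (rule newton_add_newton_0)
  qed
  with a have "real_vec a \<notin> P" by auto
  then obtain \<omega> c where \<omega>: "\<omega> \<bullet> real_vec a < c" "\<And>x. x \<in> P \<Longrightarrow> c < \<omega> \<bullet> x"
    using separating_hyperplane_closed_point[OF \<open>convex P\<close> \<open>closed P\<close>] by blast
  have bP: "real_vec b + d \<in> P" if "b \<in> B" "\<And>i. 0 \<le> d $ i" for b d
    using that by (auto simp: P_def D_def intro: hull_inc)
  have "0 \<le> \<omega> $ i" for i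
  proof (rule ccontr)
    assume neg: "\<not> 0 \<le> \<omega> $ i"
    obtain b where b: "b \<in> B" using False B(3) by auto
    \<comment> \<open>moving this far along axis \<open>i\<close> makes the weight drop below \<open>c\<close>\<close>
    define t where "t = (\<bar>\<omega> \<bullet> real_vec b\<bar> + \<bar>c\<bar>) / (- \<omega> $ i)"
    have "t \<ge> 0" using neg unfolding t_def by (intro divide_nonneg_pos) auto
    then have "c < \<omega> \<bullet> (real_vec b + axis i t)"
      by (intro \<omega>(2) bP b) (auto simp: axis_def)
    also have "\<dots> = \<omega> \<bullet> real_vec b + \<omega> $ i * t"
      by (simp add: inner_add_right inner_axis)
    also have "\<omega> $ i * t = - (\<bar>\<omega> \<bullet> real_vec b\<bar> + \<bar>c\<bar>)"
      using neg by (simp add: t_def field_simps)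
    finally show False by linarith
  qed
  moreover have "\<omega> \<bullet> real_vec a < \<omega> \<bullet> real_vec r" if r: "r \<in> R" for r
  proof -
    obtain b where b: "b \<in> B" "\<And>i. b $ i \<le> r $ i" using B(3)[OF r] by blast
    have "real_vec b + (real_vec r - real_vec b) \<in> P"
      by (intro bP b(1)) (use b(2) in \<open>simp add: real_vec_def\<close>)
    then show ?thesis using \<omega> by fastforce
  qed
  ultimately show thesis by (rule that)
qed


section \<open>Initial exponents\<close>

text \<open>The part of \<open>A\<close> on which \<open>k\<close> attains its minimum over \<open>A\<close>.\<close>

definition min_face :: "('a \<Rightarrow> 'b::ord) \<Rightarrow> 'a set \<Rightarrow> 'a set" where
  "min_face k A = {a \<in> A. \<forall>b\<in>A. k a \<le> k b}"

text \<open>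
  The exponents of least weight \<open>\<omega>\<close>, with ties broken lexicographically along \<open>xs\<close>.
\<close>

definition initial :: "real ^ 'm::finite \<Rightarrow> 'm list \<Rightarrow> (nat ^ 'm) set \<Rightarrow> (nat ^ 'm) set" where
  "initial \<omega> xs A = lexmin xs (min_face (\<lambda>a. \<omega> \<bullet> real_vec a) A)"

lemma lexmin_Cons: "lexmin (x # xs) A = lexmin xs (min_face (\<lambda>a. a $ x) A)"
  by (simp add: min_face_def)

lemma min_face_subset: "min_face k A \<subseteq> A"
  by (auto simp: min_face_def)

lemma initial_subset: "initial \<omega> xs A \<subseteq> A"
  unfolding initial_def by (rule order_trans[OF lexmin_subset min_face_subset])

lemma min_face_add_iff:
  fixes k :: "'a::plus \<Rightarrow> 'b::linordered_cancel_ab_semigroup_add"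
  assumes k: "\<And>a b. k (a + b) = k a + k b" and "a \<in> A" "b \<in> B"
  shows "a + b \<in> min_face k (A + B) \<longleftrightarrow> a \<in> min_face k A \<and> b \<in> min_face k B"
proof
  assume L: "a + b \<in> min_face k (A + B)"
  have "k a \<le> k a'" if "a' \<in> A" for a'
  proof -
    have "k (a + b) \<le> k (a' + b)"
      using L that assms(3) by (auto simp: min_face_def)
    then show ?thesis by (simp add: k)
  qed
  moreover have "k b \<le> k b'" if "b' \<in> B" for b'
  proof -
    have "k (a + b) \<le> k (a + b')"
      using L that assms(2) by (auto simp: min_face_def)
    then show ?thesis by (simp add: k)
  qed
  ultimately show "a \<in> min_face k A \<and> b \<in> min_face k B"
    using assms by (auto simp: min_face_def)
next
  assume "a \<in> min_face k A \<and> b \<in> min_face k B"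
  then show "a + b \<in> min_face k (A + B)"
    unfolding min_face_def
    by (auto simp: k elim!: set_plus_elim intro!: set_plus_intro add_mono)
qed

lemma min_face_plus:
  fixes k :: "'a::plus \<Rightarrow> 'b::linordered_cancel_ab_semigroup_add"
  assumes k: "\<And>a b. k (a + b) = k a + k b"
  shows "min_face k (A + B) = min_face k A + min_face k B"
proof (intro equalityI subsetI)
  fix p assume p: "p \<in> min_face k (A + B)"
  then have "p \<in> A + B" by (rule subsetD[OF min_face_subset])
  then obtain a b where ab: "a \<in> A" "b \<in> B" "p = a + b" by (rule set_plus_elim)
  with p show "p \<in> min_face k A + min_face k B"
    using min_face_add_iff[of k a A b B] k by auto
next
  fix p assume "p \<in> min_face k A + min_face k B"
  then obtain a b where ab: "a \<in> min_face k A" "b \<in> min_face k B" "p = a + b"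
    by (rule set_plus_elim)
  moreover have "a \<in> A" "b \<in> B" using ab(1,2) min_face_subset[of k] by blast+
  ultimately show "p \<in> min_face k (A + B)"
    using min_face_add_iff[of k a A b B] k by auto
qed

lemma lexmin_add_iff:
  fixes A B :: "(nat ^ 'm) set"
  assumes "a \<in> A" "b \<in> B"
  shows "a + b \<in> lexmin xs (A + B) \<longleftrightarrow> a \<in> lexmin xs A \<and> b \<in> lexmin xs B"
  using assms
proof (induction xs arbitrary: A B)
  case (Cons x xs)
  let ?k = "\<lambda>a :: nat ^ 'm. a $ x"
  have k: "?k (a + b) = ?k a + ?k b" for a b by simp
  show ?case
  proof (cases "a \<in> min_face ?k A \<and> b \<in> min_face ?k B")
    case True
    then show ?thesis
      unfolding lexmin_Cons min_face_plus[of ?k, OF k] by (intro Cons.IH) auto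
  next
    case False
    then have "a + b \<notin> min_face ?k (A + B)"
      using min_face_add_iff[of ?k a A b B] Cons.prems by auto
    with False show ?thesis
      unfolding lexmin_Cons using lexmin_subset by blast
  qed
qed auto

lemma initial_add_iff:
  assumes "a \<in> A" "b \<in> B"
  shows "a + b \<in> initial \<omega> xs (A + B) \<longleftrightarrow> a \<in> initial \<omega> xs A \<and> b \<in> initial \<omega> xs B"
proof -
  let ?k = "\<lambda>a. \<omega> \<bullet> real_vec a"
  have k: "?k (a + b) = ?k a + ?k b" for a b by (simp add: real_vec_add inner_add_right)
  show ?thesis
  proof (cases "a \<in> min_face ?k A \<and> b \<in> min_face ?k B")
    case True
    then show ?thesis
      unfolding initial_def min_face_plus[of ?k, OF k] by (intro lexmin_add_iff) auto
  next
    case False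
    then have "a + b \<notin> min_face ?k (A + B)"
      using min_face_add_iff[of ?k a A b B] assms k by auto
    with False show ?thesis
      unfolding initial_def using lexmin_subset by blast
  qed
qed

lemma min_face_restrict:
  "p \<in> min_face k A \<Longrightarrow> p \<in> B \<Longrightarrow> B \<subseteq> A \<Longrightarrow> p \<in> min_face k B"
  by (auto simp: min_face_def)

lemma min_face_mono_restrict:
  fixes k :: "'a \<Rightarrow> 'b::order"
  assumes "p \<in> min_face k A" "p \<in> B" "B \<subseteq> A"
  shows "min_face k B \<subseteq> min_face k A"
  using assms unfolding min_face_def by (auto intro: order_trans)

lemma lexmin_restrict: "p \<in> lexmin xs A \<Longrightarrow> p \<in> B \<Longrightarrow> B \<subseteq> A \<Longrightarrow> p \<in> lexmin xs B"
proof (induction xs arbitrary: A B)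
  case (Cons x xs)
  let ?k = "\<lambda>a. a $ x"
  have p: "p \<in> min_face ?k A" using Cons.prems(1) lexmin_subset unfolding lexmin_Cons by blast
  show ?case
    unfolding lexmin_Cons
    using Cons.IH[of "min_face ?k A" "min_face ?k B"] Cons.prems
      min_face_restrict[OF p] min_face_mono_restrict[OF p] unfolding lexmin_Cons by blast
qed auto

lemma initial_restrict:
  assumes "p \<in> initial \<omega> xs A" "p \<in> B" "B \<subseteq> A"
  shows "p \<in> initial \<omega> xs B"
proof -
  let ?k = "\<lambda>a. \<omega> \<bullet> real_vec a"
  have p: "p \<in> min_face ?k A" using assms(1) lexmin_subset unfolding initial_def by blast
  show ?thesis
    using lexmin_restrict[of p xs "min_face ?k A" "min_face ?k B"] assms
      min_face_restrict[OF p] min_face_mono_restrict[OF p] unfolding initial_def by blast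
qed

lemma initial_unique:
  assumes "set xs = UNIV" "a \<in> initial \<omega> xs A" "b \<in> initial \<omega> xs A"
  shows "a = b"
  using lexmin_eq_nth[OF assms(2,3)[unfolded initial_def]] assms(1) by (auto simp: vec_eq_iff)

text \<open>
  A nonnegative weight attains its minimum among the finitely many exponents given by Dickson's
  lemma.
\<close>

lemma initial_nonempty:
  assumes \<omega>: "\<And>i. 0 \<le> \<omega> $ i" and "A \<noteq> {}"
  shows "initial \<omega> xs A \<noteq> {}"
proof -
  let ?k = "\<lambda>a. \<omega> \<bullet> real_vec a"
  obtain B where B: "B \<subseteq> A" "finite B" "\<And>a. a \<in> A \<Longrightarrow> \<exists>b\<in>B. \<forall>i. b $ i \<le> a $ i"
    by (rule dickson[of A]) blast
  with assms(2) have "B \<noteq> {}" by fastforce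
  then obtain b where b: "b \<in> B" "\<And>b'. b' \<in> B \<Longrightarrow> ?k b \<le> ?k b'"
    using arg_min_if_finite[OF B(2), of ?k] by (meson not_le_imp_less)
  have "?k b \<le> ?k a" if a: "a \<in> A" for a
  proof -
    obtain b' where b': "b' \<in> B" "\<And>i. b' $ i \<le> a $ i" using B(3)[OF a] by blast
    have "?k b' \<le> ?k a"
      unfolding inner_vec_def using \<omega> b'(2)
      by (intro sum_mono) (auto simp: real_vec_def intro!: mult_left_mono)
    with b(2)[OF b'(1)] show ?thesis by linarith
  qed
  then have "min_face ?k A \<noteq> {}" using b(1) B(1) by (auto simp: min_face_def)
  then show ?thesis unfolding initial_def by (rule lexmin_nonempty)
qed

text \<open>
  The Boolean series \<open>F\<close> bounds the support of \<open>f\<close>, and the bound is attained at the initial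
  exponent. Products may shrink supports by cancellation, but not at initial exponents.
\<close>

definition tracks ::
  "real ^ 'm \<Rightarrow> 'm list \<Rightarrow> ('k::zero, 'm::finite) mfps \<Rightarrow> (boolean, 'm) mfps \<Rightarrow> bool" where
  "tracks \<omega> xs f F \<longleftrightarrow> supp f \<subseteq> supp F \<and> initial \<omega> xs (supp F) \<subseteq> supp f"

lemma tracks_supp_eq: "supp f = supp F \<Longrightarrow> tracks \<omega> xs f F"
  using initial_subset[of \<omega> xs "supp F"] by (simp add: tracks_def)

lemma supp_mult_subset: "supp (f * g) \<subseteq> supp f + supp g"
proof
  fix N assume "N \<in> supp (f * g)"
  then have "(\<Sum>(I, J)\<in>splits N. coeff f I * coeff g J) \<noteq> 0"
    by (simp add: supp_def coeff_mult)
  then obtain q where "q \<in> splits N" "(case q of (I, J) \<Rightarrow> coeff f I * coeff g J) \<noteq> 0"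
    by (rule sum.not_neutral_contains_not_neutral)
  then obtain I J where "(I, J) \<in> splits N" "coeff f I * coeff g J \<noteq> 0"
    by (cases q) auto
  then show "N \<in> supp f + supp g"
    by (auto simp: supp_def splits_def intro!: set_plus_intro)
qed

lemma tracks_mult:
  fixes f g :: "('k::idom, 'm::finite) mfps"
  assumes xs: "set xs = UNIV" and f: "tracks \<omega> xs f F" and g: "tracks \<omega> xs g G"
  shows "tracks \<omega> xs (f * g) (F * G)"
  unfolding tracks_def supp_boolean_mult
proof (intro conjI subsetI)
  have "supp f + supp g \<subseteq> supp F + supp G"
    using f g unfolding tracks_def by (intro set_plus_mono2) auto
  then show "p \<in> supp F + supp G" if "p \<in> supp (f * g)" for p
    using that supp_mult_subset by blast
next
  fix p assume p: "p \<in> initial \<omega> xs (supp F + supp G)"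
  then have "p \<in> supp F + supp G" using initial_subset by blast
  then obtain a b where ab: "a \<in> supp F" "b \<in> supp G" "p = a + b" by (rule set_plus_elim)
  with p have in_ab: "a \<in> initial \<omega> xs (supp F)" "b \<in> initial \<omega> xs (supp G)"
    using initial_add_iff by blast+
  then have "a \<in> supp f" "b \<in> supp g" using f g by (auto simp: tracks_def)
  have "coeff (f * g) p = (\<Sum>(I, J)\<in>{(a, b)}. coeff f I * coeff g J)"
    unfolding coeff_mult
  proof (rule sum.mono_neutral_right)
    show "\<forall>q\<in>splits p - {(a, b)}. (case q of (I, J) \<Rightarrow> coeff f I * coeff g J) = 0"
    proof (intro ballI, rule ccontr)
      fix q assume q: "q \<in> splits p - {(a, b)}"
        and ne: "(case q of (I, J) \<Rightarrow> coeff f I * coeff g J) \<noteq> 0"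
      obtain I J where [simp]: "q = (I, J)" by (cases q)
      from ne have "I \<in> supp f" "J \<in> supp g" by (auto simp: supp_def)
      then have IJ: "I \<in> supp F" "J \<in> supp G" using f g by (auto simp: tracks_def)
      have "I + J = p" using q by (auto simp: in_splits)
      with p IJ have "I \<in> initial \<omega> xs (supp F)" "J \<in> initial \<omega> xs (supp G)"
        using initial_add_iff by blast+
      then have "I = a" "J = b" using in_ab initial_unique[OF xs] by blast+
      with q show False by auto
    qed
  qed (use ab in \<open>auto simp: in_splits\<close>)
  with \<open>a \<in> supp f\<close> \<open>b \<in> supp g\<close> show "p \<in> supp (f * g)" by (simp add: supp_def)
qed

lemma tracks_1: "tracks \<omega> xs (1 :: ('k::comm_semiring_1, 'm::finite) mfps) 1"
  by (rule tracks_supp_eq) (simp add: supp_def coeff_1)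

lemma tracks_power:
  fixes f :: "('k::idom, 'm::finite) mfps"
  shows "set xs = UNIV \<Longrightarrow> tracks \<omega> xs f F \<Longrightarrow> tracks \<omega> xs (f ^ n) (F ^ n)"
  by (induction n) (auto intro: tracks_1 tracks_mult)

lemma tracks_prod:
  fixes f :: "'i \<Rightarrow> ('k::idom, 'm::finite) mfps"
  assumes "set xs = UNIV" "\<And>i. i \<in> A \<Longrightarrow> tracks \<omega> xs (f i) (F i)"
  shows "tracks \<omega> xs (prod f A) (prod F A)"
  using assms(2)
  by (induction A rule: infinite_finite_induct) (auto intro: tracks_1 tracks_mult[OF assms(1)])

lemma tracks_eval_mono:
  fixes \<phi> :: "'n \<Rightarrow> ('k::{idom, ring_char_0}, 'm::finite) mfps"
  assumes "set xs = UNIV"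
  shows "tracks \<omega> xs (eval_mono M \<phi>) (eval_mono M (\<lambda>i. trop_series (\<phi> i)))"
proof -
  have "supp (Theta J f) = supp (Theta J (trop_series f))" for J and f :: "('k, 'm) mfps"
  proof -
    have "supp (Theta J f) = {N. N + J \<in> supp f}"
      by (auto simp: supp_def coeff_Theta)
    moreover have "supp (Theta J (trop_series f)) = {N. N + J \<in> supp (trop_series f)}"
      by (auto simp: supp_def coeff_Theta)
    ultimately show ?thesis by (simp add: supp_trop_series)
  qed
  then show ?thesis
    unfolding eval_mono_def case_prod_unfold
    by (intro tracks_prod tracks_power tracks_supp_eq assms)
qed


section \<open>Tropical vanishing\<close>

lemma abs_vseries_sum: "(\<Sum>i\<in>A. abs_vseries (H i)) = abs_vseries (\<Sum>i\<in>A. H i)"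
  by (induction A rule: infinite_finite_induct) (auto simp: zero_vseries_def plus_vseries.abs_eq)

lemma supp_boolean_sum:
  fixes H :: "'i \<Rightarrow> (boolean, 'm::finite) mfps"
  shows "finite A \<Longrightarrow> supp (sum H A) = (\<Union>i\<in>A. supp (H i))"
  by (induction A rule: finite_induct) (auto simp: supp_boolean_0 supp_boolean_add)

lemma tropically_vanishes_iff_newton:
  assumes "finite A"
  shows "tropically_vanishes A (\<lambda>i. abs_vseries (H i)) \<longleftrightarrow>
    (\<forall>i\<in>A. newton (\<Union>j\<in>A. supp (H j)) = newton (\<Union>j\<in>A - {i}. supp (H j)))"
  using assms
  by (simp add: tropically_vanishes_def abs_vseries_sum vseries.abs_eq_iff supp_boolean_sum)

lemma newton_eqI:
  assumes "B \<subseteq> A" "\<And>a. a \<in> A \<Longrightarrow> real_vec a \<in> newton B"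
  shows "newton A = newton B"
proof
  show "newton A \<subseteq> newton B"
    unfolding newton_def[of A]
  proof (rule hull_minimal)
    show "{real_vec (I + J) |I J. I \<in> A} \<subseteq> newton B"
    proof
      fix v assume "v \<in> {real_vec (I + J) |I J. I \<in> A}"
      then obtain I J where "I \<in> A" "v = real_vec I + real_vec J" by (auto simp: real_vec_add)
      moreover have "real_vec J \<in> newton {0}" using real_vec_in_newton[of 0 "{0}" J] by simp
      ultimately show "v \<in> newton B" using assms(2) newton_add_newton_0 by auto
    qed
    show "convex (newton B)" by (simp add: newton_def)
  qed
qed (rule newton_mono[OF assms(1)])

text \<open>The coordinate sum is at least \<open>1\<close> on the Newton polyhedron of a set that omits \<open>0\<close>.\<close>

lemma zero_in_newton_iff: "0 \<in> newton A \<longleftrightarrow> (0 :: nat ^ 'm::finite) \<in> A"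
proof
  assume N: "0 \<in> newton A"
  show "0 \<in> A"
  proof (rule ccontr)
    assume A: "0 \<notin> A"
    let ?H = "{x :: real ^ 'm. (\<chi> i. 1) \<bullet> x \<ge> 1}"
    have "newton A \<subseteq> ?H"
      unfolding newton_def
    proof (rule hull_minimal)
      show "convex ?H" by (rule convex_halfspace_ge)
      show "{real_vec (I + J) |I J. I \<in> A} \<subseteq> ?H"
      proof
        fix v assume "v \<in> {real_vec (I + J) |I J. I \<in> A}"
        then obtain I J where I: "I \<in> A" "v = real_vec (I + J)" by auto
        with A have "I \<noteq> 0" by auto
        then obtain i where "I $ i \<noteq> 0" by (auto simp: vec_eq_iff)
        then have "1 \<le> real ((I + J) $ i)" by simp
        also have "\<dots> \<le> (\<Sum>k\<in>UNIV. real ((I + J) $ k))" by (rule member_le_sum) auto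
        finally show "v \<in> ?H" by (simp add: I inner_vec_def real_vec_def)
      qed
    qed
    with N show False by auto
  qed
next
  assume "0 \<in> A"
  from real_vec_in_newton[OF this, of 0] show "0 \<in> newton A" by simp
qed

lemma fixes P :: "('k::comm_ring_1, 'm::finite, 'n) dpoly"
  shows keys_trop: "Poly_Mapping.keys (trop P) = Poly_Mapping.keys P"
  and lookup_trop: "Poly_Mapping.lookup (trop P) M = trop_series (Poly_Mapping.lookup P M)"
proof -
  have 0: "trop_series (0 :: ('k, 'm) mfps) = 0" by (rule supp_eq_empty_iff[THEN iffD1]) (simp only: supp_trop_series supp_eq_empty_iff)
  show *: "Poly_Mapping.lookup (trop P) M = trop_series (Poly_Mapping.lookup P M)" for M
    by (simp add: trop_def Poly_Mapping.map.rep_eq when_def 0)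
  have iff: "trop_series f = 0 \<longleftrightarrow> f = 0" for f :: "('k, 'm) mfps"
    by (simp only: supp_trop_series flip: supp_eq_empty_iff)
  show "Poly_Mapping.keys (trop P) = Poly_Mapping.keys P"
    by (rule set_eqI) (simp only: in_keys_iff * iff)
qed

text \<open>
  If omitting one term shrank the Newton polyhedron, a weight would single out an initial
  exponent of the whole sum that occurs in this term alone, so the terms could not cancel there.
\<close>

lemma trop_vanishes_of_eval_poly_eq_0:
  fixes P :: "('k::{idom, ring_char_0}, 'm::finite, 'n) dpoly"
  assumes P: "eval_poly P \<phi> = 0"
  shows "tropically_vanishes (Poly_Mapping.keys (trop P))
    (\<lambda>M. abs_vseries (Poly_Mapping.lookup (trop P) M * eval_mono M (\<lambda>i. trop_series (\<phi> i))))"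
proof -
  let ?K = "Poly_Mapping.keys P"
  define h where "h M = Poly_Mapping.lookup P M * eval_mono M \<phi>" for M
  define H where "H M = trop_series (Poly_Mapping.lookup P M) * eval_mono M (\<lambda>i. trop_series (\<phi> i))" for M
  obtain xs :: "'m list" where xs: "set xs = UNIV" using finite_list[OF finite] by auto
  have tracks: "tracks \<omega> xs (h M) (H M)" for \<omega> M
    unfolding h_def H_def
    by (intro tracks_mult tracks_eval_mono xs tracks_supp_eq) (simp add: supp_trop_series)
  have "real_vec a \<in> newton (\<Union>j\<in>?K - {M}. supp (H j))"
    if M: "M \<in> ?K" and a: "a \<in> (\<Union>j\<in>?K. supp (H j))" for M a
  proof (rule ccontr)
    let ?R = "\<Union>j\<in>?K - {M}. supp (H j)" and ?T = "\<Union>j\<in>?K. supp (H j)"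
    assume "real_vec a \<notin> newton ?R"
    then obtain \<omega> :: "real ^ 'm" where \<omega>: "\<And>i. 0 \<le> \<omega> $ i"
      "\<And>r. r \<in> ?R \<Longrightarrow> \<omega> \<bullet> real_vec a < \<omega> \<bullet> real_vec r"
      using newton_separation by blast
    obtain p where p: "p \<in> initial \<omega> xs ?T"
      using initial_nonempty[of \<omega> ?T xs, OF \<omega>(1)] a by blast
    then have "p \<in> min_face (\<lambda>a. \<omega> \<bullet> real_vec a) ?T"
      using lexmin_subset unfolding initial_def by blast
    then have "\<omega> \<bullet> real_vec p \<le> \<omega> \<bullet> real_vec a" using a by (auto simp: min_face_def)
    then have pR: "p \<notin> ?R" using \<omega>(2) by fastforce
    moreover have "p \<in> ?T" using p initial_subset by blast
    ultimately have pM: "p \<in> supp (H M)" by blast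
    have "p \<in> initial \<omega> xs (supp (H M))"
      by (rule initial_restrict[OF p pM]) (use M in auto)
    then have "p \<in> supp (h M)" using tracks[of \<omega> M] by (auto simp: tracks_def)
    moreover have "coeff (h j) p = 0" if "j \<in> ?K - {M}" for j
      using pR that tracks[of \<omega> j] by (auto simp: tracks_def supp_def)
    then have "(\<Sum>j\<in>?K. coeff (h j) p) = coeff (h M) p"
      using M by (subst sum.remove[of _ M]) auto
    moreover have "(\<Sum>j\<in>?K. coeff (h j) p) = 0"
      using P by (simp add: eval_poly_def h_def flip: coeff_sum)
    ultimately show False by (simp add: supp_def)
  qed
  then have "newton (\<Union>j\<in>?K. supp (H j)) = newton (\<Union>j\<in>?K - {M}. supp (H j))" if "M \<in> ?K" for M
    using that by (intro newton_eqI) auto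
  then show ?thesis
    unfolding keys_trop lookup_trop H_def[symmetric]
    by (simp add: tropically_vanishes_iff_newton)
qed

lemma trop_series_Sol:
  fixes \<Sigma> :: "('k::{idom, ring_char_0}, 'm::finite, 'n) dpoly set"
  assumes "\<phi> \<in> Sol \<Sigma>"
  shows "(\<lambda>i. trop_series (\<phi> i)) \<in> trop_Sol (trop ` diff_ideal_of \<Sigma>)"
  using trop_vanishes_of_eval_poly_eq_0 diff_ideal_of_vanishes[OF assms]
  by (auto simp: trop_Sol_def)

text \<open>
  If \<open>unit_vec z\<close> lay in the span, the ideal would contain a linear form whose coefficient at \<open>z\<close>
  is a unit, while its coefficients at all other variables in the support of \<open>\<phi>\<close> have constant
  term zero. Then exactly one term of its tropicalization at \<open>\<phi>\<close> contains the exponent zero.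
\<close>

lemma trop_Sol_not_in_span:
  fixes \<Sigma> :: "('k::field_char_0, 'm::finite, 'n) dpoly set"
  assumes \<phi>: "\<phi> \<in> trop_Sol (trop ` diff_ideal_of \<Sigma>)" and S: "S = flatten (\<lambda>i. supp (\<phi> i))"
    and z: "z \<in> S"
  shows "unit_vec z \<notin> pmvs.span (const_term_functionals \<Sigma> \<union> unit_vec ` (- S))"
proof
  let ?x = "\<lambda>v :: ('m, 'n) dvar. Poly_Mapping.single v (1 :: nat)"
  assume "unit_vec z \<in> pmvs.span (const_term_functionals \<Sigma> \<union> unit_vec ` (- S))"
  then obtain v u where vu: "unit_vec z = v + u" "v \<in> pmvs.span (const_term_functionals \<Sigma>)"
    "u \<in> pmvs.span (unit_vec ` (- S))"
    unfolding pmvs.span_Un by blast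
  from vu(2) have "v \<in> const_term_functionals \<Sigma>"
    by (simp add: pmvs.span_eq_iff[THEN iffD2, OF subspace_const_term_functionals])
  then obtain Q where Q: "Q \<in> diff_ideal_of \<Sigma>" "linear_homogeneous Q" "v = const_term_functional Q"
    by (auto simp: const_term_functionals_def)
  have "pmvs.span (unit_vec ` (- S)) \<subseteq> {u. \<forall>x\<in>S. Poly_Mapping.lookup u x = 0}"
    by (rule pmvs.span_minimal)
       (auto simp: lookup_single when_def lookup_add intro!: pmvs.subspaceI)
  with vu(3) have u0: "Poly_Mapping.lookup u x = 0" if "x \<in> S" for x using that by auto
  have coeff_Q: "coeff (Poly_Mapping.lookup Q (?x x)) 0 \<noteq> 0 \<longleftrightarrow> x = z" if x: "x \<in> S" for x
  proof -
    have "Poly_Mapping.lookup v x = (if x = z then 1 else 0)"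
      using arg_cong[OF vu(1), of "\<lambda>p. Poly_Mapping.lookup p x"] u0[OF x]
      by (auto simp: lookup_add lookup_single when_def)
    then show ?thesis
      unfolding Q(3) by (auto simp: const_term_functional.rep_eq split: if_splits)
  qed
  define H where "H M = trop_series (Poly_Mapping.lookup Q M) * eval_mono M \<phi>" for M
  have zero_H: "0 \<in> supp (H (?x x)) \<longleftrightarrow> coeff (Poly_Mapping.lookup Q (?x x)) 0 \<noteq> 0 \<and> x \<in> S" for x
  proof -
    obtain i J where x: "x = (i, J)" by (cases x)
    have "0 \<in> supp (H (?x x)) \<longleftrightarrow>
        0 \<in> supp (trop_series (Poly_Mapping.lookup Q (?x x))) \<and> 0 \<in> supp (Theta J (\<phi> i))"
      unfolding H_def x eval_mono_single by (simp add: supp_def coeff_mult_0)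
    also have "0 \<in> supp (Theta J (\<phi> i)) \<longleftrightarrow> x \<in> S"
      by (auto simp: x S flatten_def supp_def coeff_Theta)
    also have "0 \<in> supp (trop_series (Poly_Mapping.lookup Q (?x x))) \<longleftrightarrow>
        coeff (Poly_Mapping.lookup Q (?x x)) 0 \<noteq> 0"
      by (simp only: supp_trop_series) (simp add: supp_def)
    finally show ?thesis .
  qed
  let ?K = "Poly_Mapping.keys Q"
  have zK: "?x z \<in> ?K" using coeff_Q[OF z] by (auto simp: in_keys_iff)
  have "tropically_vanishes ?K (\<lambda>M. abs_vseries (H M))"
    using \<phi> Q(1) by (auto simp: trop_Sol_def keys_trop lookup_trop H_def)
  then have "newton (\<Union>M\<in>?K. supp (H M)) = newton (\<Union>M\<in>?K - {?x z}. supp (H M))"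
    using zK by (simp add: tropically_vanishes_iff_newton)
  moreover have "0 \<in> (\<Union>M\<in>?K. supp (H M))"
    using zK zero_H[of z] coeff_Q[OF z] z by blast
  ultimately have "0 \<in> (\<Union>M\<in>?K - {?x z}. supp (H M))"
    by (simp only: zero_in_newton_iff[symmetric])
  then obtain M where M: "M \<in> ?K" "M \<noteq> ?x z" "0 \<in> supp (H M)" by blast
  then obtain x where x: "M = ?x x" using Q(2) unfolding linear_homogeneous_def by blast
  with M(3) zero_H[of x] coeff_Q[of x] have "x = z" by blast
  with M(2) x show False by simp
qed

theorem flatten_supports_trop_Sol:
  fixes \<Sigma> :: "('k::field_char_0, 'm::finite, 'n::finite) dpoly set"
  assumes unc: "uncountable (UNIV :: 'k set)" and lin: "\<forall>P\<in>\<Sigma>. linear_homogeneous P"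
  shows "flatten ` supports (trop_Sol (trop ` diff_ideal_of \<Sigma>)) =
    nonzeros ` annihilator (const_term_functionals \<Sigma>)"
proof (intro equalityI subsetI)
  fix S assume "S \<in> flatten ` supports (trop_Sol (trop ` diff_ideal_of \<Sigma>))"
  then obtain \<phi> where "\<phi> \<in> trop_Sol (trop ` diff_ideal_of \<Sigma>)" "S = flatten (\<lambda>i. supp (\<phi> i))"
    by (auto simp: supports_def)
  then show "S \<in> nonzeros ` annihilator (const_term_functionals \<Sigma>)"
    by (intro exists_support[OF unc] trop_Sol_not_in_span)
next
  fix S assume "S \<in> nonzeros ` annihilator (const_term_functionals \<Sigma>)"
  then obtain \<phi> where \<phi>: "\<phi> \<in> Sol \<Sigma>" "S = flatten (\<lambda>i. supp (\<phi> i))"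
    unfolding flatten_supports_Sol[OF lin, symmetric] by (auto simp: supports_def)
  then have "S = flatten (\<lambda>i. supp (trop_series (\<phi> i)))" by (simp add: supp_trop_series)
  moreover have "(\<lambda>i. supp (trop_series (\<phi> i))) \<in> supports (trop_Sol (trop ` diff_ideal_of \<Sigma>))"
    unfolding supports_def using trop_series_Sol[OF \<phi>(1)]
    by (intro CollectI exI[of _ "\<lambda>i. trop_series (\<phi> i)"] conjI refl)
  ultimately show "S \<in> flatten ` supports (trop_Sol (trop ` diff_ideal_of \<Sigma>))" by simp
qed

theorem corollary5p8:
  fixes \<Sigma> :: "('k::{alg_closed_field, field_char_0}, 'm::finite, 'n::finite) dpoly set"
    and U :: "(boolean, 'm, 'n) dpoly set"
    and X :: "('n \<Rightarrow> (boolean, 'm) mfps) set"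
  assumes "uncountable (UNIV :: 'k set)"
    and "X = trop_Sol U"
    and "U = trop ` diff_ideal_of \<Sigma>"
    and "\<forall>P\<in>\<Sigma>. linear_homogeneous P"
    and "differential_type_zero \<Sigma>"
  shows "matroid_circuits UNIV (flatten ` minimal_supports (Sol \<Sigma>)) \<and>
         flatten ` supports X = scrawls (flatten ` minimal_supports (Sol \<Sigma>))"
  unfolding assms(2,3) flatten_minimal_supports[OF assms(4)]
    flatten_supports_trop_Sol[OF assms(1,4)] scrawls_support_circuits[OF assms(1)]
  by (simp add: matroid_support_circuits)

end
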